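(* Let $d,P\in\mathbb{N}$, $b\in\mathbb{R}^d$, $\sigma=(\sigma_1,\ldots,\sigma_P)\in\mathbb{R}^{d\times P}$ with columns $\sigma_j\in\mathbb{R}^d$, and let $\mu\ge 0$ be a Radon measure on $\mathbb{R}^d\setminus\{0\}$ with $\int_{\mathbb{R}^d\setminus\{0\}}\min\{|z|^2,1\}\,\mathrm{d}\mu(z)<\infty$. Let $\mathcal{L}=\mathcal{L}^{\sigma,b}+\mathcal{L}^{\mu}$. Then the following statements are equivalent: (a) If $u\in L^\infty(\mathbb{R}^d)$ satisfies $\mathcal{L}[u]=0$ in $\mathcal{D}'(\mathbb{R}^d)$, then $u$ is a.e. equal to a constant. (b) $\overline{G_\mu+W_{\sigma,b+c_\mu}}=\mathbb{R}^d$.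
   Context: Operators: for smooth bounded $u$ with bounded derivatives, $$\mathcal{L}^{\sigma,b}[u](x)=\mathrm{tr}(\sigma\sigma^{\mathtt T}D^2u(x))+b\cdot Du(x),$$ $$\mathcal{L}^{\mu}[u](x)=\int_{\mathbb{R}^d\setminus\{0\}}\big(u(x+z)-u(x)-z\cdot Du(x)\mathbf{1}_{|z|\le 1}\big)\,\mathrm{d}\mu(z).$$ For $u\in L^\infty(\mathbb{R}^d)$, the distribution $\mathcal{L}[u]\in\mathcal{D}'(\mathbb{R}^d)$ is defined by $\langle\mathcal{L}[u],\psi\rangle=\int_{\mathbb{R}^d}u(x)\,\mathcal{L}^*[\psi](x)\,\mathrm{d}x$ for all $\psi\in C^\infty_{\mathrm c}(\mathbb{R}^d)$, where $\mathcal{L}^*=\mathcal{L}^{\sigma,-b}+\mathcal{L}^{\mu^*}$ and $\mathrm{d}\mu^*(z)=\mathrm{d}\mu(-z)$ (this is well-defined since $\mathcal{L}^*:W^{2,1}(\mathbb{R}^d)\to L^1(\mathbb{R}^d)$ is bounded). Support and groups: $\mathrm{supp}(\mu)=\{z\in\mathbb{R}^d\setminus\{0\}:\mu(B_r(z))>0\ \forall r>0\}$, where $B_r(z)$ is the ball of center $z$ and radius $r$. For $S\subseteq\mathbb{R}^d$, $G(S)$ is the smallest additive subgroup of $\mathbb{R}^d$ containing $S$. Set $G_\mu=\overline{G(\mathrm{supp}(\mu))}$ and $V_\mu=\{g\in G_\mu: tg\in G_\mu\ \forall t\in\mathbb{R}\}$ (a vector subspace of $\mathbb{R}^d$). Drift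 correction: $c_\mu=-\int_{\{|z|\le1\}\setminus V_\mu}z\,\mathrm{d}\mu(z)\in\mathbb{R}^d$ (the integral is well-defined). Finally $W_{\sigma,b+c_\mu}=\mathrm{span}_{\mathbb{R}}\{\sigma_1,\ldots,\sigma_P,b+c_\mu\}$. *)

theory Defs
  imports "HOL-Analysis.Analysis" "HOL-Computational_Algebra.Group_Closure"
begin

section \<open>Smooth functions, gradients and Hessians\<close>

definition partial :: "'n::finite \<Rightarrow> (real ^ 'n \<Rightarrow> real) \<Rightarrow> real ^ 'n \<Rightarrow> real" where
  "partial i f x = frechet_derivative f (at x) (axis i 1)"

text \<open>
  Asking every iterated partial derivative to be differentiable in the sense of Frechet is the same
  as asking all partial derivatives of all orders to exist and to be continuous. Since the
  condition covers all index lists, each \<open>frechet_derivative\<close> that is taken exists.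
\<close>

definition smooth :: "(real ^ 'n::finite \<Rightarrow> real) \<Rightarrow> bool" where
  "smooth f \<longleftrightarrow> (\<forall>is x. foldr partial is f differentiable (at x))"

definition test_function :: "(real ^ 'n::finite \<Rightarrow> real) \<Rightarrow> bool" where
  "test_function \<psi> \<longleftrightarrow> smooth \<psi> \<and> compact (closure {x. \<psi> x \<noteq> 0})"

definition gradient :: "(real ^ 'n::finite \<Rightarrow> real) \<Rightarrow> real ^ 'n \<Rightarrow> real ^ 'n" where
  "gradient f x = (\<chi> i. partial i f x)"

definition hessian :: "(real ^ 'n::finite \<Rightarrow> real) \<Rightarrow> real ^ 'n \<Rightarrow> real ^ 'n ^ 'n" where
  "hessian f x = (\<chi> i j. partial i (partial j f) x)"

section \<open>Radon and Levy measures\<close>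

text \<open>
  A measure on an open set \<open>U\<close> has space \<open>U\<close>. In particular \<^const>\<open>emeasure\<close> of a measure on
  \<open>- {0}\<close> vanishes, by the totality convention, on every set that contains \<open>0\<close>; hence the
  explicit removal of \<open>0\<close> in \<open>msupp\<close> below.
\<close>

definition radon_measure_on :: "'a::topological_space set \<Rightarrow> 'a measure \<Rightarrow> bool" where
  "radon_measure_on U M \<longleftrightarrow>
     sets M = sets (restrict_space borel U) \<and>
     (\<forall>K. compact K \<and> K \<subseteq> U \<longrightarrow> emeasure M K < \<infinity>) \<and>
     (\<forall>A \<in> sets M. emeasure M A = (SUP K \<in> {K. compact K \<and> K \<subseteq> A}. emeasure M K))"

definition levy_measure :: "(real ^ 'n::finite) measure \<Rightarrow> bool" where
  "levy_measure \<mu> \<longleftrightarrow>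
     radon_measure_on (- {0}) \<mu> \<and>
     (\<integral>\<^sup>+ z. ennreal (min ((norm z)\<^sup>2) 1) \<partial>\<mu>) < \<infinity>"

definition reflect_measure :: "(real ^ 'n::finite) measure \<Rightarrow> (real ^ 'n) measure" where
  "reflect_measure \<mu> = distr \<mu> \<mu> uminus"

definition msupp :: "(real ^ 'n::finite) measure \<Rightarrow> (real ^ 'n) set" where
  "msupp \<mu> = {z. z \<noteq> 0 \<and> (\<forall>r>0. emeasure \<mu> (ball z r - {0}) > 0)}"

section \<open>The operator\<close>

definition local_op ::
    "real ^ 'p::finite ^ 'n::finite \<Rightarrow> real ^ 'n \<Rightarrow> (real ^ 'n \<Rightarrow> real) \<Rightarrow> real ^ 'n \<Rightarrow> real" where
  "local_op \<sigma> b u x = trace (\<sigma> ** transpose \<sigma> ** hessian u x) + b \<bullet> gradient u x"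

definition nonlocal_op ::
    "(real ^ 'n::finite) measure \<Rightarrow> (real ^ 'n \<Rightarrow> real) \<Rightarrow> real ^ 'n \<Rightarrow> real" where
  "nonlocal_op \<mu> u x =
     (LINT z|\<mu>. u (x + z) - u x - z \<bullet> gradient u x * indicator {z. norm z \<le> 1} z)"

definition full_op ::
    "real ^ 'p::finite ^ 'n::finite \<Rightarrow> real ^ 'n \<Rightarrow> (real ^ 'n) measure \<Rightarrow>
     (real ^ 'n \<Rightarrow> real) \<Rightarrow> real ^ 'n \<Rightarrow> real" where
  "full_op \<sigma> b \<mu> u x = local_op \<sigma> b u x + nonlocal_op \<mu> u x"

definition adjoint_op ::
    "real ^ 'p::finite ^ 'n::finite \<Rightarrow> real ^ 'n \<Rightarrow> (real ^ 'n) measure \<Rightarrow>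
     (real ^ 'n \<Rightarrow> real) \<Rightarrow> real ^ 'n \<Rightarrow> real" where
  "adjoint_op \<sigma> b \<mu> = full_op \<sigma> (- b) (reflect_measure \<mu>)"

definition L_infty :: "(real ^ 'n::finite \<Rightarrow> real) set" where
  "L_infty = {u \<in> borel_measurable lebesgue. \<exists>C. AE x in lebesgue. \<bar>u x\<bar> \<le> C}"

text \<open>The pairing of the distribution \<open>L[u]\<close>, for bounded \<open>u\<close>, with a test function \<open>\<psi>\<close>.\<close>

definition op_distribution ::
    "real ^ 'p::finite ^ 'n::finite \<Rightarrow> real ^ 'n \<Rightarrow> (real ^ 'n) measure \<Rightarrow>
     (real ^ 'n \<Rightarrow> real) \<Rightarrow> (real ^ 'n \<Rightarrow> real) \<Rightarrow> real" where
  "op_distribution \<sigma> b \<mu> u \<psi> = (LINT x|lebesgue. u x * adjoint_op \<sigma> b \<mu> \<psi> x)"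

section \<open>Groups and subspaces attached to the operator\<close>

text \<open>
  \<^const>\<open>group_closure\<close> is the inductively defined, hence smallest, set that contains the given
  set and \<open>0\<close> and is closed under differences.
\<close>

definition G_of :: "(real ^ 'n::finite) measure \<Rightarrow> (real ^ 'n) set" where
  "G_of \<mu> = closure (group_closure (msupp \<mu>))"

definition V_of :: "(real ^ 'n::finite) measure \<Rightarrow> (real ^ 'n) set" where
  "V_of \<mu> = {g \<in> G_of \<mu>. \<forall>t::real. t *\<^sub>R g \<in> G_of \<mu>}"

definition c_of :: "(real ^ 'n::finite) measure \<Rightarrow> real ^ 'n" where
  "c_of \<mu> = - (LINT z : {z. norm z \<le> 1} - V_of \<mu> | \<mu>. z)"

definition W_of :: "real ^ 'p::finite ^ 'n::finite \<Rightarrow> real ^ 'n \<Rightarrow> (real ^ 'n) set" where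
  "W_of \<sigma> v = span (columns \<sigma> \<union> {v})"

end

theory Submission
  imports Defs "HOL-Computational_Algebra.Polynomial"
begin

text \<open>
  Pairing a bounded \<open>u\<close> with the translates of a test function \<open>\<psi>\<close> gives a smooth function
  \<open>f x = \<integral> u y * \<psi> (y - x) dy\<close> with bounded derivatives, and by Fubini the pairing of \<open>L[u]\<close>
  with the translate of \<open>\<psi>\<close> by \<open>x\<close> is the pointwise value \<open>L[f](x)\<close>. So \<open>L[u] = 0\<close> means that
  \<open>L[f] = 0\<close> for all these \<open>f\<close>.

  If \<open>L[f] = 0\<close> and \<open>g\<close> is in the support of \<open>\<mu>\<close>, the maximum principle applied to
  \<open>f (x + g) - f x\<close> shows that being near the supremum propagates from \<open>x\<close> to \<open>x + g\<close>; a positive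
  supremum would therefore make \<open>f\<close> unbounded along \<open>x + n g\<close>. Hence \<open>f\<close> is
  \<open>G\<^sub>\<mu>\<close>-periodic, and on such functions \<open>L\<close> reduces to the local operator with drift
  \<open>b + c\<^sub>\<mu>\<close>. A reflection coupling shows that bounded solutions of the local equation are constant
  along the diffusion directions, and then along the drift. If \<open>G\<^sub>\<mu> + W\<close> is dense, every \<open>f\<close> is
  constant, and so is \<open>u\<close>.

  Conversely, the truncated distance to \<open>G\<^sub>\<mu> + W\<close> is a bounded periodic function, so it solves the
  equation, and it is constant only if \<open>G\<^sub>\<mu> + W\<close> is dense.
\<close>

section \<open>Smooth functions with bounded derivatives\<close>

text \<open>A supremum over the whole space need not be attained. Both maximum principle arguments
  therefore add a small bump at an almost maximal point, which forces a global maximum, at the price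
  of a bounded error from the operator applied to the bump. The local operator may be fully
  degenerate; the coupling trades one diffusion direction for a new variable on a strip, and the
  barrier disappears as the width of the strip tends to infinity. The integral in
  \<open>c_of\<close> exists because a closed subgroup has no elements arbitrarily close to 0
  outside its largest subspace; so on the part of the support that counts, |z| is bounded by a
  multiple of |z|^2. The truncated distance need not be differentiable, but its regularisations are
  smooth and inherit its periods, and the equation is tested on these only. That constancy of every
  \<open>f\<close> forces \<open>u\<close> to be constant rests on the uniqueness of Lebesgue
  measure: after adding a constant and rescaling, \<open>u\<close> is a density with the right mass
  on every box.\<close>

lemma partial_add:
  assumes "\<And>x. f differentiable (at x)" "\<And>x. g differentiable (at x)"
  shows "partial i (\<lambda>x. f x + g x) = (\<lambda>x. partial i f x + partial i g x)"
proof
  fix x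
  have "((\<lambda>x. f x + g x) has_derivative (\<lambda>h. frechet_derivative f (at x) h + frechet_derivative g (at x) h)) (at x)"
    using assms by (intro has_derivative_add) (auto simp: frechet_derivative_works)
  from frechet_derivative_at[OF this]
  show "partial i (\<lambda>x. f x + g x) x = partial i f x + partial i g x"
    by (simp add: partial_def fun_eq_iff)
qed

lemma partial_cmult:
  assumes "\<And>x. f differentiable (at x)"
  shows "partial i (\<lambda>x. c * f x) = (\<lambda>x. c * partial i f x)"
proof
  fix x
  have "((\<lambda>x. c * f x) has_derivative (\<lambda>h. c * frechet_derivative f (at x) h)) (at x)"
    using assms by (intro has_derivative_mult_right) (auto simp: frechet_derivative_works)
  from frechet_derivative_at[OF this]
  show "partial i (\<lambda>x. c * f x) x = c * partial i f x"
    by (simp add: partial_def fun_eq_iff)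
qed

lemma partial_shift:
  assumes "\<And>x. f differentiable (at x)"
  shows "partial i (\<lambda>x. f (x + a)) = (\<lambda>x. partial i f (x + a))"
proof
  fix x
  have 1: "(f has_derivative frechet_derivative f (at (x + a))) (at (x + a))"
    using assms by (auto simp: frechet_derivative_works)
  have "((\<lambda>x. x + a) has_derivative (\<lambda>h. h)) (at x)"
    by (auto intro!: derivative_eq_intros)
  from has_derivative_compose[OF this 1]
  have "((\<lambda>x. f (x + a)) has_derivative frechet_derivative f (at (x + a))) (at x)" by simp
  from frechet_derivative_at[OF this]
  show "partial i (\<lambda>x. f (x + a)) x = partial i f (x + a)"
    by (simp add: partial_def fun_eq_iff)
qed

text \<open>Iterated partials never leave a family closed under \<open>partial\<close>. Smoothness
  proofs, here and in the bounded variant, thus amount to naming such a family.\<close>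

lemma smooth_coinduct:
  assumes "f \<in> F" and "\<And>g x. g \<in> F \<Longrightarrow> g differentiable (at x)"
    and "\<And>g i. g \<in> F \<Longrightarrow> partial i g \<in> F"
  shows "smooth f"
proof -
  have "foldr partial is f \<in> F" for "is"
    by (induction "is") (auto intro: assms)
  then show ?thesis by (auto simp: smooth_def intro: assms)
qed

lemma smooth_partial: "smooth f \<Longrightarrow> smooth (partial i f)"
  unfolding smooth_def
proof (intro allI)
  fix "is" x assume "\<forall>is x. foldr partial is f differentiable at x"
  \<comment> \<open>The index appended at the end belongs to the innermost derivative, the one taken
    first.\<close>
  then have "foldr partial (is @ [i]) f differentiable at x" by blast
  then show "foldr partial is (partial i f) differentiable at x" by simp
qed

lemma smooth_differentiable: "smooth f \<Longrightarrow> f differentiable (at x)"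
  unfolding smooth_def by (metis foldr_Nil id_apply)

lemma smooth_continuous: "smooth f \<Longrightarrow> continuous_on UNIV f"
  by (simp add: continuous_at_imp_continuous_on differentiable_imp_continuous_within smooth_differentiable)

text \<open>The common home of test functions and regularisations; stable under derivatives, linear
  combinations and translations.\<close>

definition smooth_bdd :: "(real ^ 'n::finite \<Rightarrow> real) \<Rightarrow> bool" where
  "smooth_bdd f \<longleftrightarrow> smooth f \<and> (\<forall>is. bounded (range (foldr partial is f)))"

lemma smooth_bdd_coinduct:
  assumes "f \<in> F" and "\<And>g x. g \<in> F \<Longrightarrow> g differentiable (at x)"
    and "\<And>g i. g \<in> F \<Longrightarrow> partial i g \<in> F"
    and "\<And>g. g \<in> F \<Longrightarrow> \<exists>C. \<forall>x. \<bar>g x\<bar> \<le> C"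
  shows "smooth_bdd f"
proof -
  have "foldr partial is f \<in> F" for "is"
    by (induction "is") (auto intro: assms)
  then have "bounded (range (foldr partial is f))" for "is"
    using assms(4) by (fastforce simp: bounded_iff)
  with smooth_coinduct[of f F] assms show ?thesis by (auto simp: smooth_bdd_def)
qed

lemma smooth_bdd_partial: "smooth_bdd f \<Longrightarrow> smooth_bdd (partial i f)"
  unfolding smooth_bdd_def
proof (intro conjI allI; elim conjE)
  show "smooth f \<Longrightarrow> smooth (partial i f)" by (rule smooth_partial)
  fix "is" assume "\<forall>is. bounded (range (foldr partial is f))"
  then have "bounded (range (foldr partial (is @ [i]) f))" by blast
  then show "bounded (range (foldr partial is (partial i f)))" by simp
qed

lemma smooth_bdd_differentiable: "smooth_bdd f \<Longrightarrow> f differentiable (at x)"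
  by (simp add: smooth_bdd_def smooth_differentiable)

lemma smooth_bdd_bound: "smooth_bdd f \<Longrightarrow> \<exists>C\<ge>0. \<forall>x. \<bar>f x\<bar> \<le> C"
proof -
  assume "smooth_bdd f"
  then have "bounded (range (foldr partial [] f))" unfolding smooth_bdd_def by blast
  then have "bounded (range f)" by simp
  then obtain C where "C > 0" "\<forall>x. \<bar>f x\<bar> \<le> C" by (auto simp: bounded_pos)
  then show ?thesis by (intro exI[of _ C]) auto
qed

lemma smooth_bdd_continuous: "smooth_bdd f \<Longrightarrow> continuous_on S f"
  using smooth_bdd_def smooth_continuous continuous_on_subset by blast

lemma smooth_bdd_borel: "smooth_bdd f \<Longrightarrow> f \<in> borel_measurable borel"
  by (simp add: borel_measurable_continuous_onI smooth_bdd_continuous)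

lemma smooth_bdd_add:
  assumes "smooth_bdd f" "smooth_bdd g"
  shows "smooth_bdd (\<lambda>x. f x + g x)"
proof (rule smooth_bdd_coinduct[where F="{\<lambda>x. f x + g x | f g. smooth_bdd f \<and> smooth_bdd g}"])
  fix h i assume "h \<in> {\<lambda>x. f x + g x | f g. smooth_bdd f \<and> smooth_bdd g}"
  then obtain f g where h: "h = (\<lambda>x. f x + g x)" "smooth_bdd f" "smooth_bdd g" by auto
  then have "partial i h = (\<lambda>x. partial i f x + partial i g x)"
    by (simp add: partial_add smooth_bdd_differentiable)
  with h show "partial i h \<in> {\<lambda>x. f x + g x | f g. smooth_bdd f \<and> smooth_bdd g}"
    using smooth_bdd_partial by blast
next
  fix h assume "h \<in> {\<lambda>x. f x + g x | f g. smooth_bdd f \<and> smooth_bdd g}"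
  then obtain f g where h: "h = (\<lambda>x. f x + g x)" "smooth_bdd f" "smooth_bdd g" by auto
  obtain A B where "\<And>x. \<bar>f x\<bar> \<le> A" "\<And>x. \<bar>g x\<bar> \<le> B" using smooth_bdd_bound h(2,3) by meson
  then have "\<bar>h x\<bar> \<le> A + B" for x unfolding h by (meson abs_triangle_ineq add_mono order_trans)
  then show "\<exists>C. \<forall>x. \<bar>h x\<bar> \<le> C" by blast
qed (use assms in \<open>auto intro: derivative_intros smooth_bdd_differentiable\<close>)

lemma smooth_bdd_cmult:
  assumes "smooth_bdd f"
  shows "smooth_bdd (\<lambda>x. c * f x)"
proof (rule smooth_bdd_coinduct[where F="{\<lambda>x. c * f x | f. smooth_bdd f}"])
  fix h i assume "h \<in> {\<lambda>x. c * f x | f. smooth_bdd f}"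
  then obtain f where h: "h = (\<lambda>x. c * f x)" "smooth_bdd f" by auto
  then have "partial i h = (\<lambda>x. c * partial i f x)"
    by (simp add: partial_cmult smooth_bdd_differentiable)
  with h show "partial i h \<in> {\<lambda>x. c * f x | f. smooth_bdd f}"
    using smooth_bdd_partial by blast
next
  fix h assume "h \<in> {\<lambda>x. c * f x | f. smooth_bdd f}"
  then obtain f where h: "h = (\<lambda>x. c * f x)" "smooth_bdd f" by auto
  obtain A where "\<And>x. \<bar>f x\<bar> \<le> A" using smooth_bdd_bound h(2) by meson
  then have "\<bar>h x\<bar> \<le> \<bar>c\<bar> * A" for x unfolding h by (simp add: abs_mult mult_left_mono)
  then show "\<exists>C. \<forall>x. \<bar>h x\<bar> \<le> C" by blast
qed (use assms in \<open>auto intro: derivative_intros smooth_bdd_differentiable\<close>)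

lemma differentiable_shift:
  fixes f :: "real ^ 'n::finite \<Rightarrow> real"
  assumes "f differentiable (at (x + a))"
  shows "(\<lambda>x. f (x + a)) differentiable (at x)"
proof -
  from assms obtain D where 1: "(f has_derivative D) (at (x + a))" by (auto simp: differentiable_def)
  have "((\<lambda>x. x + a) has_derivative (\<lambda>h. h)) (at x)"
    by (auto intro!: derivative_eq_intros)
  from has_derivative_compose[OF this 1] show ?thesis by (auto simp: differentiable_def)
qed

lemma smooth_bdd_shift:
  assumes "smooth_bdd f"
  shows "smooth_bdd (\<lambda>x. f (x + a))"
proof (rule smooth_bdd_coinduct[where F="{\<lambda>x. f (x + a) | f. smooth_bdd f}"])
  fix h i assume "h \<in> {\<lambda>x. f (x + a) | f. smooth_bdd f}"
  then obtain f where h: "h = (\<lambda>x. f (x + a))" "smooth_bdd f" by auto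
  then have "partial i h = (\<lambda>x. partial i f (x + a))"
    by (simp add: partial_shift smooth_bdd_differentiable)
  with h show "partial i h \<in> {\<lambda>x. f (x + a) | f. smooth_bdd f}"
    using smooth_bdd_partial by blast
next
  fix h assume "h \<in> {\<lambda>x. f (x + a) | f. smooth_bdd f}"
  then obtain f where h: "h = (\<lambda>x. f (x + a))" "smooth_bdd f" by auto
  then show "\<exists>C. \<forall>x. \<bar>h x\<bar> \<le> C" using smooth_bdd_bound h(2) by meson
qed (use assms in \<open>auto intro: differentiable_shift smooth_bdd_differentiable\<close>)

lemma smooth_bdd_zero: "smooth_bdd (\<lambda>x. 0)"
  by (rule smooth_bdd_coinduct[where F="{\<lambda>x. 0}"]) (auto simp: partial_def)

lemma smooth_bdd_sum:
  assumes "\<And>i. i \<in> I \<Longrightarrow> smooth_bdd (f i)"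
  shows "smooth_bdd (\<lambda>x. \<Sum>i\<in>I. f i x)"
  using assms by (induction I rule: infinite_finite_induct) (auto intro: smooth_bdd_zero smooth_bdd_add)

section \<open>Directional derivatives\<close>

definition ddir :: "real ^ 'n::finite \<Rightarrow> (real ^ 'n \<Rightarrow> real) \<Rightarrow> real ^ 'n \<Rightarrow> real" where
  "ddir v f x = v \<bullet> gradient f x"

lemma ddir_sum: "ddir v f x = (\<Sum>i\<in>UNIV. v $ i * partial i f x)"
  by (simp add: ddir_def gradient_def inner_vec_def)

lemma ddir_has_derivative:
  assumes "f differentiable (at x)"
  shows "(f has_derivative (\<lambda>v. ddir v f x)) (at x)"
proof -
  have D: "(f has_derivative frechet_derivative f (at x)) (at x)"
    using assms by (simp add: frechet_derivative_works)
  then interpret bounded_linear "frechet_derivative f (at x)" by (rule has_derivative_bounded_linear)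
  have "frechet_derivative f (at x) v = ddir v f x" for v
  proof -
    have "v = (\<Sum>i\<in>UNIV. v $ i *\<^sub>R axis i 1)"
      using basis_expansion[of v] by (simp add: scalar_mult_eq_scaleR)
    then have "frechet_derivative f (at x) v = frechet_derivative f (at x) (\<Sum>i\<in>UNIV. v $ i *\<^sub>R axis i 1)" by simp
    also have "\<dots> = ddir v f x"
      by (simp add: sum scaleR ddir_sum partial_def)
    finally show ?thesis .
  qed
  with D show ?thesis by (metis (no_types, lifting) ext)
qed

lemma ddir_smooth_bdd: "smooth_bdd f \<Longrightarrow> smooth_bdd (ddir v f)"
  unfolding ddir_sum[abs_def] by (intro smooth_bdd_sum smooth_bdd_cmult smooth_bdd_partial)

lemma gradient_add:
  assumes "smooth_bdd f" "smooth_bdd g"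
  shows "gradient (\<lambda>x. f x + g x) x = gradient f x + gradient g x"
  using assms by (simp add: gradient_def partial_add smooth_bdd_differentiable vec_eq_iff)

lemma gradient_cmult:
  assumes "smooth_bdd f"
  shows "gradient (\<lambda>x. c * f x) x = c *\<^sub>R gradient f x"
  using assms by (simp add: gradient_def partial_cmult smooth_bdd_differentiable vec_eq_iff)

lemma gradient_shift:
  assumes "smooth_bdd f"
  shows "gradient (\<lambda>x. f (x + a)) x = gradient f (x + a)"
  using assms by (simp add: gradient_def partial_shift smooth_bdd_differentiable vec_eq_iff)

lemma ddir_add:
  assumes "smooth_bdd f" "smooth_bdd g"
  shows "ddir v (\<lambda>x. f x + g x) = (\<lambda>x. ddir v f x + ddir v g x)"
  using assms by (simp add: ddir_def gradient_add inner_add_right fun_eq_iff)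

lemma ddir_cmult:
  assumes "smooth_bdd f"
  shows "ddir v (\<lambda>x. c * f x) = (\<lambda>x. c * ddir v f x)"
  using assms by (simp add: ddir_def gradient_cmult fun_eq_iff)

lemma ddir_shift:
  assumes "smooth_bdd f"
  shows "ddir v (\<lambda>x. f (x + a)) = (\<lambda>x. ddir v f (x + a))"
  using assms by (simp add: ddir_def gradient_shift fun_eq_iff)

lemma ddir_line:
  assumes "smooth_bdd f"
  shows "((\<lambda>t. f (x + t *\<^sub>R v)) has_real_derivative ddir v f (x + t *\<^sub>R v)) (at t)"
proof -
  have "((\<lambda>t. x + t *\<^sub>R v) has_derivative (\<lambda>s. s *\<^sub>R v)) (at t)"
    by (auto intro!: derivative_eq_intros)
  from has_derivative_compose[OF this ddir_has_derivative[OF smooth_bdd_differentiable[OF assms]]]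
  show ?thesis
    by (simp add: has_field_derivative_def ddir_def mult.commute[of _ "v \<bullet> _"] mult_commute_abs)
qed

lemma gradient_bound:
  assumes "smooth_bdd f"
  shows "\<exists>C\<ge>0. \<forall>x. norm (gradient f x) \<le> C"
proof -
  have "\<forall>i. \<exists>C\<ge>0. \<forall>x. \<bar>partial i f x\<bar> \<le> C"
    using smooth_bdd_bound smooth_bdd_partial assms by blast
  then obtain C where C: "\<And>i. C i \<ge> 0" "\<And>i x. \<bar>partial i f x\<bar> \<le> C i" by metis
  have "norm (gradient f x) \<le> (\<Sum>i\<in>UNIV. C i)" for x
  proof -
    have "norm (gradient f x) \<le> (\<Sum>i\<in>UNIV. \<bar>gradient f x $ i\<bar>)" by (rule norm_le_l1_cart)
    also have "\<dots> \<le> (\<Sum>i\<in>UNIV. C i)" by (intro sum_mono) (simp add: gradient_def C)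
    finally show ?thesis .
  qed
  then show ?thesis using C(1) by (meson sum_nonneg)
qed

lemma smooth_bdd_lipschitz:
  assumes "smooth_bdd f"
  shows "\<exists>C\<ge>0. \<forall>x y. \<bar>f x - f y\<bar> \<le> C * norm (x - y)"
proof -
  obtain C where C: "C \<ge> 0" "\<And>x. norm (gradient f x) \<le> C" using gradient_bound[OF assms] by blast
  have "norm (f x - f y) \<le> C * norm (x - y)" for x y
  proof (rule differentiable_bound[where S=UNIV and f'="\<lambda>x v. ddir v f x"])
    show "(f has_derivative (\<lambda>v. ddir v f x)) (at x within UNIV)" for x
      using ddir_has_derivative smooth_bdd_differentiable assms by blast
    show "onorm (\<lambda>v. ddir v f x) \<le> C" for x
    proof (rule onorm_bound[OF C(1)])
      fix v
      have "norm (ddir v f x) \<le> norm v * norm (gradient f x)"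
        unfolding ddir_def real_norm_def by (rule Cauchy_Schwarz_ineq2)
      also have "\<dots> \<le> norm v * C" by (intro mult_left_mono C) simp
      finally show "norm (ddir v f x) \<le> C * norm v" by (simp add: mult.commute)
    qed
  qed auto
  with C(1) show ?thesis by auto
qed

lemma gradient_lipschitz:
  assumes "smooth_bdd f"
  shows "\<exists>C\<ge>0. \<forall>x y. norm (gradient f x - gradient f y) \<le> C * norm (x - y)"
proof -
  have "\<forall>i. \<exists>C\<ge>0. \<forall>x y. \<bar>partial i f x - partial i f y\<bar> \<le> C * norm (x - y)"
    using smooth_bdd_lipschitz smooth_bdd_partial assms by blast
  then obtain C where C: "\<And>i. C i \<ge> 0" "\<And>i x y. \<bar>partial i f x - partial i f y\<bar> \<le> C i * norm (x - y)" by metis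
  have "norm (gradient f x - gradient f y) \<le> (\<Sum>i\<in>UNIV. C i) * norm (x - y)" for x y
  proof -
    have "norm (gradient f x - gradient f y) \<le> (\<Sum>i\<in>UNIV. \<bar>(gradient f x - gradient f y) $ i\<bar>)" by (rule norm_le_l1_cart)
    also have "\<dots> \<le> (\<Sum>i\<in>UNIV. C i * norm (x - y))" by (intro sum_mono) (simp add: gradient_def C)
    finally show ?thesis by (simp add: sum_distrib_right)
  qed
  then show ?thesis using C(1) by (meson sum_nonneg)
qed

text \<open>The mean value theorem on the segment leaves a difference of gradients, and gradients
  are Lipschitz. Uniformity in \<open>x\<close> is what the jump integral and differentiation under
  the integral sign require.\<close>

lemma taylor2:
  assumes "smooth_bdd f"
  shows "\<exists>C\<ge>0. \<forall>x z. \<bar>f (x + z) - f x - z \<bullet> gradient f x\<bar> \<le> C * (norm z)\<^sup>2"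
proof -
  obtain C where C: "C \<ge> 0" "\<And>x y. norm (gradient f x - gradient f y) \<le> C * norm (x - y)"
    using gradient_lipschitz[OF assms] by blast
  have "\<bar>f (x + z) - f x - z \<bullet> gradient f x\<bar> \<le> C * (norm z)\<^sup>2" for x z
  proof -
    have "\<exists>t::real. t > 0 \<and> t < 1 \<and> f (x + 1 *\<^sub>R z) - f (x + 0 *\<^sub>R z) = (1 - 0) * ddir z f (x + t *\<^sub>R z)"
      by (rule MVT2) (auto intro: ddir_line assms)
    then obtain t :: real where t: "t > 0" "t < 1" and e: "f (x + z) - f x = ddir z f (x + t *\<^sub>R z)" by auto
    have "\<bar>f (x + z) - f x - z \<bullet> gradient f x\<bar> = \<bar>z \<bullet> (gradient f (x + t *\<^sub>R z) - gradient f x)\<bar>"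
      by (simp add: e ddir_def inner_diff_right)
    also have "\<dots> \<le> norm z * norm (gradient f (x + t *\<^sub>R z) - gradient f x)" by (rule Cauchy_Schwarz_ineq2)
    also have "\<dots> \<le> norm z * (C * norm (x + t *\<^sub>R z - x))" by (intro mult_left_mono C) auto
    also have "\<dots> \<le> norm z * (C * norm z)"
      using t C(1) by (intro mult_left_mono) (auto simp: mult_left_le_one_le)
    finally show ?thesis by (simp add: power2_eq_square mult_ac)
  qed
  with C(1) show ?thesis by blast
qed

section \<open>Calculus at a maximum\<close>

text \<open>Were \<open>D\<close> positive, \<open>f'\<close> would be positive just to the right of
  its zero \<open>a\<close>, and the mean value theorem would give a value above
  \<open>f a\<close>.\<close>

lemma max_second_derivative:
  fixes f f' :: "real \<Rightarrow> real"
  assumes f: "\<And>t. \<bar>t - a\<bar> < d \<Longrightarrow> (f has_real_derivative f' t) (at t)"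
    and f': "(f' has_real_derivative D) (at a)"
    and d: "d > 0" and m: "\<And>t. \<bar>t - a\<bar> < d \<Longrightarrow> f t \<le> f a"
  shows "f' a = 0 \<and> D \<le> 0"
proof -
  have z: "f' a = 0"
    using DERIV_local_max[OF f d, of a] d m by (auto simp: abs_minus_commute)
  moreover have "D \<le> 0"
  proof (rule ccontr)
    assume "\<not> D \<le> 0"
    then obtain e where e: "e > 0" "\<And>h. h > 0 \<Longrightarrow> h < e \<Longrightarrow> f' a < f' (a + h)"
      using DERIV_pos_inc_right[OF f'] by auto
    define h where "h = min (d / 2) (e / 2)"
    have h: "h > 0" "h < d" "h < e" using d e(1) by (auto simp: h_def min_def)
    have "\<exists>t>a. t < a + h \<and> f (a + h) - f a = (a + h - a) * f' t"
      using h by (intro MVT2 f) auto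
    then obtain t where t: "t > a" "t < a + h" "f (a + h) - f a = h * f' t" by auto
    have "f' t > 0" using e(2)[of "t - a"] t h z by auto
    then have "f (a + h) > f a" using t h by (smt (verit) mult_pos_pos)
    with m[of "a + h"] h show False by auto
  qed
  ultimately show ?thesis ..
qed

lemma smooth_bdd_max:
  assumes f: "smooth_bdd f" and m: "\<And>z. f z \<le> f x"
  shows "gradient f x = 0" and "ddir v (ddir v f) x \<le> 0"
proof -
  have D: "ddir v f x = 0 \<and> ddir v (ddir v f) x \<le> 0" for v
    using max_second_derivative[of 0 1 "\<lambda>t. f (x + t *\<^sub>R v)" "\<lambda>t. ddir v f (x + t *\<^sub>R v)" "ddir v (ddir v f) x"]
      ddir_line[OF f, of x v] ddir_line[OF ddir_smooth_bdd[OF f], of v x v 0] m by auto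
  then show "ddir v (ddir v f) x \<le> 0" by simp
  \<comment> \<open>The derivative along the gradient is the squared norm of the gradient.\<close>
  from D[of "gradient f x"] show "gradient f x = 0" by (simp add: ddir_def)
qed

section \<open>The local operator\<close>

text \<open>\<sigma>\<sigma>^T is the sum over the columns of column times transposed column, so the
  trace splits into second derivatives along the columns, each nonpositive at a maximum. Only the
  symmetry of \<sigma>\<sigma>^T enters, not that of the Hessian.\<close>

lemma local_op_eq:
  fixes \<sigma> :: "real ^ 'p::finite ^ 'n::finite"
  assumes "smooth_bdd f"
  shows "local_op \<sigma> b f x =
    (\<Sum>j\<in>UNIV. ddir (column j \<sigma>) (ddir (column j \<sigma>) f) x) + b \<bullet> gradient f x"
proof -
  have "ddir v (ddir v f) x = (\<Sum>k\<in>UNIV. \<Sum>i\<in>UNIV. v $ k * v $ i * partial k (partial i f) x)" for v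
  proof -
    have p: "partial k (ddir v f) x = (\<Sum>i\<in>UNIV. v $ i * partial k (partial i f) x)" for k
    proof -
      have s: "partial k (\<lambda>x. \<Sum>i\<in>I. v $ i * partial i f x) = (\<lambda>x. \<Sum>i\<in>I. v $ i * partial k (partial i f) x)"
        if "finite I" for I
        using that
      proof (induction I)
        case empty
        then show ?case by (auto simp: partial_def)
      next
        case (insert j I)
        have "partial k (\<lambda>x. v $ j * partial j f x + (\<Sum>i\<in>I. v $ i * partial i f x)) =
          (\<lambda>x. partial k (\<lambda>x. v $ j * partial j f x) x + partial k (\<lambda>x. (\<Sum>i\<in>I. v $ i * partial i f x)) x)"
          by (intro partial_add smooth_bdd_differentiable smooth_bdd_sum smooth_bdd_cmult smooth_bdd_partial assms)
        with insert show ?case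
          by (simp add: partial_cmult smooth_bdd_differentiable smooth_bdd_partial assms)
      qed
      show ?thesis unfolding ddir_sum[abs_def] by (subst s) auto
    qed
    show ?thesis by (simp add: ddir_sum[of v "ddir v f"] p sum_distrib_left mult.assoc)
  qed
  then have "(\<Sum>j\<in>UNIV. ddir (column j \<sigma>) (ddir (column j \<sigma>) f) x)
     = (\<Sum>j\<in>UNIV. \<Sum>k\<in>UNIV. \<Sum>i\<in>UNIV. \<sigma> $ k $ j * \<sigma> $ i $ j * partial k (partial i f) x)"
    by (simp add: column_def)
  also have "\<dots> = (\<Sum>k\<in>UNIV. \<Sum>i\<in>UNIV. \<Sum>j\<in>UNIV. \<sigma> $ k $ j * \<sigma> $ i $ j * partial k (partial i f) x)"
    by (subst sum.swap, intro sum.cong refl, rule sum.swap)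
  also have "\<dots> = (\<Sum>i\<in>UNIV. \<Sum>k\<in>UNIV. \<Sum>j\<in>UNIV. \<sigma> $ i $ j * \<sigma> $ k $ j * partial k (partial i f) x)"
    by (subst sum.swap) (simp add: mult.commute)
  also have "\<dots> = trace (\<sigma> ** transpose \<sigma> ** hessian f x)"
    by (simp add: trace_def matrix_matrix_mult_def transpose_def hessian_def sum_distrib_right)
  finally show ?thesis by (simp add: local_op_def)
qed

section \<open>Test functions\<close>

text \<open>For the two places beyond the calculus rules: the endpoints of the bumps, and
  regularisations, where the derivative is taken under the integral.\<close>

lemma has_derivative_quadratic_remainder:
  fixes f :: "'a::real_normed_vector \<Rightarrow> 'b::real_normed_vector"
  assumes "bounded_linear D" and "\<And>h. norm h < 1 \<Longrightarrow> norm (f (x + h) - f x - D h) \<le> K * (norm h)\<^sup>2"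
  shows "(f has_derivative D) (at x)"
  unfolding has_derivative_at
proof (intro conjI assms(1))
  have l: "((\<lambda>h::'a. K * norm h) \<longlongrightarrow> 0) (at 0)"
    by (intro tendsto_mult_right_zero tendsto_norm_zero tendsto_ident_at)
  have "\<forall>\<^sub>F h in at 0. norm (norm (f (x + h) - f x - D h) / norm h) \<le> K * norm h"
  proof -
    have "norm (norm (f (x + h) - f x - D h) / norm h) \<le> K * norm h" if "h \<noteq> 0" "norm h < 1" for h
      using assms(2)[of h] that by (simp add: divide_le_eq power2_eq_square mult_ac)
    then show ?thesis by (auto simp: eventually_at dist_norm intro!: exI[of _ 1])
  qed
  from Lim_null_comparison[OF this l]
  show "(\<lambda>h. norm (f (x + h) - f x - D h) / norm h) \<midarrow>0\<rightarrow> 0" .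
qed

text \<open>
  The parameters \<open>p\<close> and \<open>k\<close> make the family closed under differentiation; \<open>a \<rightarrow> 0\<close> yields
  approximations of the indicator function of an interval.
\<close>

definition bump :: "real \<Rightarrow> real poly \<Rightarrow> nat \<Rightarrow> real \<Rightarrow> real" where
  "bump a p k t = (if \<bar>t\<bar> < 1 then poly p t * inverse (1 - t\<^sup>2) ^ k * exp (- a * inverse (1 - t\<^sup>2)) else 0)"

text \<open>A single term of the series of \<open>exp (a * x)\<close> is below the whole
  sum.\<close>

lemma power_exp_bounded:
  fixes a :: real
  assumes "a > 0" "x \<ge> 0"
  shows "x ^ n * exp (- a * x) \<le> fact n / a ^ n"
proof -
  have s: "(\<lambda>k. (a * x) ^ k /\<^sub>R fact k) sums exp (a * x)" by (rule exp_converges)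
  have "(\<Sum>k\<in>{n}. (a * x) ^ k /\<^sub>R fact k) \<le> exp (a * x)"
    unfolding sums_unique[OF s] using assms by (intro sum_le_suminf sums_summable[OF s]) auto
  then have "a ^ n * x ^ n / fact n \<le> exp (a * x)" by (simp add: divide_inverse power_mult_distrib mult_ac)
  then show ?thesis using assms(1) by (simp add: exp_minus field_simps)
qed

lemma one_minus_square_pos: "\<bar>t\<bar> < 1 \<Longrightarrow> 0 < 1 - t\<^sup>2" for t :: real
  by (simp add: abs_square_less_1)

text \<open>The exponential absorbs \<open>k + 2\<close> powers of
  \<open>inverse (1 - t\<^sup>2)\<close>. The two spare ones leave a double zero at the endpoints,
  hence derivative 0 there.\<close>

lemma bump_bound:
  assumes "a > 0"
  shows "\<exists>C\<ge>0. \<forall>t. \<bar>bump a p k t\<bar> \<le> C * (1 - t\<^sup>2)\<^sup>2"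
proof -
  have "compact (poly p ` {-1..1})" by (intro compact_continuous_image continuous_intros) simp
  then have "bounded (poly p ` {-1..1})" by (rule compact_imp_bounded)
  then obtain A where "A > 0" and A': "\<forall>y\<in>poly p ` {-1..1}. norm y \<le> A" unfolding bounded_pos by blast
  then have A: "A > 0" "\<And>t. t \<in> {-1..1} \<Longrightarrow> \<bar>poly p t\<bar> \<le> A" by (auto simp: ball_simps)
  define C where "C = A * (fact (k + 2) / a ^ (k + 2))"
  have C0: "C \<ge> 0" using A(1) assms by (simp add: C_def)
  have "\<bar>bump a p k t\<bar> \<le> C * (1 - t\<^sup>2)\<^sup>2" for t
  proof (cases "\<bar>t\<bar> < 1")
    case True
    define X where "X = inverse (1 - t\<^sup>2)"
    have X: "X > 0" "X * (1 - t\<^sup>2) = 1" using one_minus_square_pos[OF True] by (auto simp: X_def)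
    have "X ^ (k + 2) * (1 - t\<^sup>2)\<^sup>2 = X ^ k * (X * (1 - t\<^sup>2))\<^sup>2"
      by (simp only: power_add power_mult_distrib mult.assoc)
    then have "X ^ k = X ^ (k + 2) * (1 - t\<^sup>2)\<^sup>2" using X(2) by simp
    then have "\<bar>bump a p k t\<bar> = \<bar>poly p t\<bar> * (X ^ (k + 2) * exp (- a * X)) * (1 - t\<^sup>2)\<^sup>2"
      using True X(1) by (simp add: bump_def X_def[symmetric] abs_mult mult_ac)
    also have "\<dots> \<le> A * (fact (k + 2) / a ^ (k + 2)) * (1 - t\<^sup>2)\<^sup>2"
      using A True X(1) assms by (intro mult_right_mono mult_mono power_exp_bounded) (auto simp: abs_less_iff)
    finally show ?thesis by (simp add: C_def)
  qed (use C0 in \<open>simp add: bump_def\<close>)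
  with C0 show ?thesis by blast
qed

text \<open>Put X = 1/(1 - t^2), so X' = 2tX^2. Differentiating the three factors gives multiples of
  X^k, X^(k+1) and X^(k+2); extracting X^(k+2) leaves this polynomial, where
  \<open>[:1, 0, -1:]\<close> is 1 - t^2.\<close>

definition bump_deriv_poly :: "real \<Rightarrow> real poly \<Rightarrow> nat \<Rightarrow> real poly" where
  "bump_deriv_poly a p k = pderiv p * [:1, 0, -1:]\<^sup>2 + [:0, 2 * of_nat k:] * p * [:1, 0, -1:] - [:0, 2 * a:] * p"

lemma bump_has_derivative:
  assumes a: "a > 0"
  shows "(bump a p k has_real_derivative bump a (bump_deriv_poly a p k) (k + 2) t) (at t)"
proof -
  consider "\<bar>t\<bar> < 1" | "\<bar>t\<bar> > 1" | "\<bar>t\<bar> = 1" by linarith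
  then show ?thesis
  proof cases
    case 1
    have o: "open {-1<..<1::real}" by simp
    define X where "X = inverse (1 - t\<^sup>2)"
    have X: "X * (1 - t\<^sup>2) = 1" "1 - t\<^sup>2 \<noteq> 0" using one_minus_square_pos[OF 1] by (auto simp: X_def)
    have D: "((\<lambda>t. poly p t * inverse (1 - t\<^sup>2) ^ k * exp (- a * inverse (1 - t\<^sup>2))) has_real_derivative
      (poly (pderiv p) t * X ^ k + poly p t * (of_nat k * X ^ (k - 1) * (2 * t * X\<^sup>2))
        - poly p t * X ^ k * (2 * a * t * X\<^sup>2)) * exp (- a * X)) (at t)"
    proof -
      have dX: "((\<lambda>t. inverse (1 - t\<^sup>2)) has_real_derivative 2 * t * X\<^sup>2) (at t)"
        using X(2) unfolding X_def by (auto intro!: derivative_eq_intros simp: power2_eq_square)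
      have "((\<lambda>t. poly p t * inverse (1 - t\<^sup>2) ^ k * exp (- a * inverse (1 - t\<^sup>2))) has_real_derivative
        (poly (pderiv p) t * X ^ k + (of_nat k * (2 * t * X\<^sup>2 * X ^ (k - Suc 0))) * poly p t) * exp (- a * X)
          + exp (- a * X) * (- a * (2 * t * X\<^sup>2)) * (poly p t * X ^ k)) (at t)"
        unfolding X_def
        by (intro DERIV_mult DERIV_fun_exp DERIV_power DERIV_cmult poly_DERIV dX[unfolded X_def])
      then show ?thesis by (rule DERIV_cong) (simp add: algebra_simps)
    qed
    \<comment> \<open>For \<open>k = 0\<close> the truncated exponent \<open>k - 1\<close> is 0 as
      well; the factor \<open>of_nat k\<close> makes both sides vanish.\<close>
    have k1: "of_nat k * X ^ (k - 1) * X\<^sup>2 = of_nat k * (X ^ (k + 2) * (1 - t\<^sup>2))"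
    proof (cases k)
      case (Suc l)
      have "X ^ (k + 2) * (1 - t\<^sup>2) = X ^ (k + 1) * (X * (1 - t\<^sup>2))" by simp
      then show ?thesis using Suc X(1) by (simp add: power2_eq_square mult_ac)
    qed simp
    have "X ^ (k + 2) * (1 - t\<^sup>2)\<^sup>2 = X ^ k * (X * (1 - t\<^sup>2))\<^sup>2"
      by (simp only: power_add power_mult_distrib mult.assoc)
    then have k0: "X ^ k = X ^ (k + 2) * (1 - t\<^sup>2)\<^sup>2" using X(1) by simp
    have "poly (pderiv p) t * X ^ k + poly p t * (of_nat k * X ^ (k - 1) * (2 * t * X\<^sup>2))
        - poly p t * X ^ k * (2 * a * t * X\<^sup>2) =
      poly (pderiv p) t * X ^ k + poly p t * (2 * t) * (of_nat k * X ^ (k - 1) * X\<^sup>2)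
        - poly p t * (2 * a * t) * X ^ (k + 2)"
      by (simp add: power_add power2_eq_square mult_ac)
    also have "\<dots> = poly (bump_deriv_poly a p k) t * X ^ (k + 2)"
      unfolding k1 by (subst k0) (simp add: bump_deriv_poly_def power2_eq_square algebra_simps)
    finally have e: "(poly (pderiv p) t * X ^ k + poly p t * (of_nat k * X ^ (k - 1) * (2 * t * X\<^sup>2))
        - poly p t * X ^ k * (2 * a * t * X\<^sup>2)) * exp (- a * X) = bump a (bump_deriv_poly a p k) (k + 2) t"
      using 1 by (simp add: bump_def X_def)
    show ?thesis
      by (rule has_field_derivative_transform_within_open[OF D[unfolded e] o]) (use 1 in \<open>auto simp: bump_def abs_less_iff\<close>)
  next
    case 2
    have "((\<lambda>t. 0) has_real_derivative 0) (at t)" by simp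
    moreover have "open {t::real. 1 < \<bar>t\<bar>}" by (intro open_Collect_less continuous_intros)
    ultimately have "(bump a p k has_real_derivative 0) (at t)"
      by (rule has_field_derivative_transform_within_open) (use 2 in \<open>auto simp: bump_def\<close>)
    then show ?thesis using 2 by (simp add: bump_def)
  next
    case 3
    obtain C where C: "C \<ge> 0" "\<And>t. \<bar>bump a p k t\<bar> \<le> C * (1 - t\<^sup>2)\<^sup>2" using bump_bound[OF a] by blast
    have "(bump a p k has_derivative (\<lambda>h. 0)) (at t)"
    proof (rule has_derivative_quadratic_remainder[where K="C * 4\<^sup>2"])
      fix h :: real assume h: "norm h < 1"
      \<comment> \<open>As t^2 = 1, this is of order h, and the double zero from
        \<open>bump_bound\<close> makes the remainder of order h^2.\<close>
      have "1 - (t + h)\<^sup>2 = - h * (2 * t + h)" using 3 power2_eq_iff[of t 1]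
        by (auto simp: power2_eq_square algebra_simps abs_if split: if_splits)
      then have "(1 - (t + h)\<^sup>2)\<^sup>2 = h\<^sup>2 * (2 * t + h)\<^sup>2" by (simp add: power_mult_distrib)
      also have "\<dots> \<le> h\<^sup>2 * 4\<^sup>2"
      proof -
        have "\<bar>2 * t + h\<bar> \<le> \<bar>4\<bar>" using 3 h by auto
        then show ?thesis by (intro mult_left_mono) (simp_all only: abs_le_square_iff zero_le_power2)
      qed
      finally have "C * (1 - (t + h)\<^sup>2)\<^sup>2 \<le> C * (h\<^sup>2 * 4\<^sup>2)" using C(1) by (intro mult_left_mono)
      with C(2)[of "t + h"] show "norm (bump a p k (t + h) - bump a p k t - 0) \<le> C * 4\<^sup>2 * (norm h)\<^sup>2"
        using 3 by (simp add: bump_def[of _ _ _ t] mult_ac)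
    qed simp
    then have "(bump a p k has_derivative (*) 0) (at t)"
      by (metis (no_types, lifting) ext mult_zero_left)
    then show ?thesis using 3 by (simp add: bump_def[of _ _ _ t] has_field_derivative_def)
  qed
qed

lemma bump_smult: "bump a (smult c p) k t = c * bump a p k t"
  by (simp add: bump_def)

text \<open>Centre \<open>m\<close>, half-widths \<open>w\<close>. Polynomials and exponents depend
  on the coordinate because a partial derivative changes one factor only; this closes the family
  under \<open>partial\<close>.\<close>

definition box_bump :: "real \<Rightarrow> ('n \<Rightarrow> real poly) \<Rightarrow> ('n \<Rightarrow> nat) \<Rightarrow> real ^ 'n::finite \<Rightarrow> real ^ 'n \<Rightarrow> real ^ 'n \<Rightarrow> real" where
  "box_bump a p k m w x = (\<Prod>i\<in>UNIV. bump a (p i) (k i) ((x $ i - m $ i) / w $ i))"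

lemma box_bump_has_derivative:
  assumes a: "a > 0"
  shows "(box_bump a p k m w has_derivative (\<lambda>y. \<Sum>i\<in>UNIV. y $ i *
    box_bump a (p(i := smult (1 / w $ i) (bump_deriv_poly a (p i) (k i)))) (k(i := k i + 2)) m w x)) (at x)"
proof -
  have 1: "((\<lambda>x. bump a (p i) (k i) ((x $ i - m $ i) / w $ i)) has_derivative
    (\<lambda>y. y $ i * bump a (smult (1 / w $ i) (bump_deriv_poly a (p i) (k i))) (k i + 2) ((x $ i - m $ i) / w $ i))) (at x)" for i
  proof -
    have "((\<lambda>x. (x $ i - m $ i) / w $ i) has_derivative (\<lambda>y. y $ i / w $ i)) (at x)"
    proof -
      have "bounded_linear (\<lambda>y. y $ i / w $ i)"
        using bounded_linear_compose[OF bounded_linear_divide[of "w $ i"] bounded_linear_vec_nth[of i]]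
        by (simp add: o_def)
      then have "((\<lambda>y. y $ i / w $ i) has_derivative (\<lambda>y. y $ i / w $ i)) (at x)"
        by (rule bounded_linear_imp_has_derivative)
      from has_derivative_diff[OF this has_derivative_const[of "m $ i / w $ i"]]
      show ?thesis by (simp add: diff_divide_distrib)
    qed
    from has_derivative_compose[OF this bump_has_derivative[OF a, unfolded has_field_derivative_def]]
    show ?thesis
      by (rule has_derivative_eq_rhs) (simp add: bump_smult fun_eq_iff)
  qed
  have "((\<lambda>x. \<Prod>i\<in>UNIV. bump a (p i) (k i) ((x $ i - m $ i) / w $ i)) has_derivative
    (\<lambda>y. \<Sum>i\<in>UNIV. (y $ i * bump a (smult (1 / w $ i) (bump_deriv_poly a (p i) (k i))) (k i + 2) ((x $ i - m $ i) / w $ i))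
      * (\<Prod>j\<in>UNIV - {i}. bump a (p j) (k j) ((x $ j - m $ j) / w $ j)))) (at x)"
    by (rule has_derivative_prod) (rule 1)
  moreover have "box_bump a (p(i := q)) (k(i := l)) m w x = bump a q l ((x $ i - m $ i) / w $ i) *
     (\<Prod>j\<in>UNIV - {i}. bump a (p j) (k j) ((x $ j - m $ j) / w $ j))" for i q l
    unfolding box_bump_def by (subst prod.remove[of _ i]) auto
  ultimately show ?thesis unfolding box_bump_def[of a p k m w, abs_def] by (simp add: mult.assoc)
qed

lemma partial_box_bump:
  assumes a: "a > 0"
  shows "partial i (box_bump a p k m w) =
    box_bump a (p(i := smult (1 / w $ i) (bump_deriv_poly a (p i) (k i)))) (k(i := k i + 2)) m w"
proof
  fix x
  let ?b = "\<lambda>i. box_bump a (p(i := smult (1 / w $ i) (bump_deriv_poly a (p i) (k i)))) (k(i := k i + 2)) m w x"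
  have "partial i (box_bump a p k m w) x = (\<Sum>j\<in>UNIV. axis i 1 $ j * ?b j)"
    using fun_cong[OF frechet_derivative_at[OF box_bump_has_derivative[OF a, of p k m w x]], of "axis i 1"]
    by (simp add: partial_def)
  also have "\<dots> = (\<Sum>j\<in>UNIV. if j = i then ?b j else 0)"
    by (intro sum.cong) (auto simp: axis_def)
  finally show "partial i (box_bump a p k m w) x = ?b i" by simp
qed

lemma box_bump_outside:
  assumes w: "\<And>i. w $ i > 0" and "x \<notin> box (m - w) (m + w)"
  shows "box_bump a p k m w x = 0"
proof -
  from assms(2) obtain i where "\<not> (m $ i - w $ i < x $ i \<and> x $ i < m $ i + w $ i)" by (auto simp: mem_box_cart)
  then have "\<not> \<bar>(x $ i - m $ i) / w $ i\<bar> < 1" using w[of i] by (auto simp: abs_less_iff field_simps)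
  then show ?thesis unfolding box_bump_def by (auto intro!: prod_zero exI[of _ i] simp: bump_def)
qed

lemma test_function_box_bump:
  assumes a: "a > 0" and w: "\<And>i. w $ i > 0"
  shows "test_function (box_bump a p k m w)"
  unfolding test_function_def
proof
  show "smooth (box_bump a p k m w)"
    by (rule smooth_coinduct[where F="{box_bump a p k m w | p k. True}"])
      (use box_bump_has_derivative[OF a] in \<open>auto simp: partial_box_bump[OF a] differentiable_def simp del: add_2_eq_Suc'\<close>; blast)+
  have "{x. box_bump a p k m w x \<noteq> 0} \<subseteq> box (m - w) (m + w)" using box_bump_outside[OF w] by blast
  then show "compact (closure {x. box_bump a p k m w x \<noteq> 0})"
    unfolding compact_closure by (rule bounded_subset[OF bounded_box])
qed

lemma box_bump_range:
  fixes x :: "real ^ 'n::finite"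
  assumes a: "a > 0"
  shows "0 \<le> box_bump a (\<lambda>_. 1) (\<lambda>_. 0) m w x" "box_bump a (\<lambda>_. 1) (\<lambda>_. 0) m w x \<le> exp (- a) ^ CARD('n)"
proof -
  have b: "0 \<le> bump a 1 0 t \<and> bump a 1 0 t \<le> exp (- a)" for t
  proof (cases "\<bar>t\<bar> < 1")
    case True
    have "1 \<le> inverse (1 - t\<^sup>2)" using one_minus_square_pos[OF True] by (intro one_le_inverse) auto
    then show ?thesis using True a by (simp add: bump_def)
  qed (simp add: bump_def)
  then show "0 \<le> box_bump a (\<lambda>_. 1) (\<lambda>_. 0) m w x" by (auto simp: box_bump_def intro!: prod_nonneg)
  show "box_bump a (\<lambda>_. 1) (\<lambda>_. 0) m w x \<le> exp (- a) ^ CARD('n)"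
    unfolding box_bump_def prod_constant[symmetric] using b by (intro prod_mono) auto
qed

lemma test_function_continuous: "test_function \<psi> \<Longrightarrow> continuous_on S \<psi>"
  unfolding test_function_def using smooth_continuous continuous_on_subset by blast

lemma test_function_support:
  assumes "test_function \<psi>"
  shows "\<exists>R>0. \<forall>x. norm x > R \<longrightarrow> \<psi> x = 0"
proof -
  have "bounded {x. \<psi> x \<noteq> 0}" using assms by (simp add: test_function_def compact_closure)
  then show ?thesis by (auto simp: bounded_pos) (metis linorder_not_less)
qed

lemma test_function_partial:
  assumes "test_function \<psi>"
  shows "test_function (partial i \<psi>)"
proof -
  have "partial i \<psi> x = 0" if "x \<notin> closure {x. \<psi> x \<noteq> 0}" for x
  proof -
    have "((\<lambda>x. 0) has_derivative (\<lambda>h. 0)) (at x)" by simp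
    then have "(\<psi> has_derivative (\<lambda>h. 0)) (at x)"
      by (rule has_derivative_transform_within_open[where s="- closure {x. \<psi> x \<noteq> 0}"])
        (use that closure_subset[of "{x. \<psi> x \<noteq> 0}"] in auto)
    from frechet_derivative_at[OF this] show ?thesis by (simp add: partial_def fun_eq_iff)
  qed
  then have "{x. partial i \<psi> x \<noteq> 0} \<subseteq> closure {x. \<psi> x \<noteq> 0}" by blast
  moreover have "bounded (closure {x. \<psi> x \<noteq> 0})"
    using assms by (simp add: test_function_def compact_imp_bounded)
  ultimately have "compact (closure {x. partial i \<psi> x \<noteq> 0})"
    unfolding compact_closure by (metis bounded_subset)
  then show ?thesis using assms by (auto simp: test_function_def intro: smooth_partial)
qed

lemma test_function_smooth_bdd:
  assumes "test_function \<psi>"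
  shows "smooth_bdd \<psi>"
proof (rule smooth_bdd_coinduct[where F="Collect test_function"])
  fix g :: "real ^ 'n \<Rightarrow> real" assume "g \<in> Collect test_function"
  then have g: "test_function g" by simp
  have "compact (g ` closure {x. g x \<noteq> 0})"
    using g by (intro compact_continuous_image test_function_continuous) (auto simp: test_function_def)
  then have "bounded (g ` closure {x. g x \<noteq> 0})" by (rule compact_imp_bounded)
  then obtain C where "C > 0" and C': "\<forall>y\<in>g ` closure {x. g x \<noteq> 0}. norm y \<le> C" unfolding bounded_pos by blast
  then have C: "\<And>x. x \<in> closure {x. g x \<noteq> 0} \<Longrightarrow> \<bar>g x\<bar> \<le> C" "C > 0" by (auto simp: ball_simps)
  have "\<bar>g x\<bar> \<le> C" for x
    using C(1)[of x] C(2) closure_subset[of "{x. g x \<noteq> 0}"] by (cases "g x = 0") auto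
  then show "\<exists>C. \<forall>x. \<bar>g x\<bar> \<le> C" by blast
next
  fix g :: "real ^ 'n \<Rightarrow> real" and x assume "g \<in> Collect test_function"
  then show "g differentiable at x" by (simp add: test_function_def smooth_differentiable)
qed (use assms in \<open>auto intro: test_function_partial\<close>)

text \<open>Half-width \<open>r / CARD('n)\<close> puts the cube inside the ball of radius
  \<open>r\<close> for the 1-norm, hence for the Euclidean norm. The factor
  \<open>exp 1 ^ CARD('n)\<close> cancels the value \<open>exp (- 1)\<close> of each coordinate bump
  at the centre.\<close>

lemma exists_bump:
  fixes r :: real
  assumes "r > 0"
  shows "\<exists>\<eta> :: real ^ 'n::finite \<Rightarrow> real. test_function \<eta> \<and> \<eta> 0 = 1 \<and>
    (\<forall>x. 0 \<le> \<eta> x \<and> \<eta> x \<le> 1) \<and> (\<forall>x. norm x \<ge> r \<longrightarrow> \<eta> x = 0)"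
proof -
  let ?b = "box_bump 1 (\<lambda>_. 1) (\<lambda>_. 0) 0 (\<chi> i. r / real CARD('n)) :: real ^ 'n \<Rightarrow> real"
  let ?c = "exp 1 ^ CARD('n) :: real"
  have w: "(\<chi> i. r / real CARD('n)) $ i > 0" for i :: 'n using assms by simp
  have t: "test_function ?b" by (rule test_function_box_bump[OF _ w]) simp
  have o: "?b x = 0" if "norm x \<ge> r" for x
  proof (rule ccontr)
    assume "?b x \<noteq> 0"
    then have "x \<in> box (0 - (\<chi> i. r / real CARD('n))) (0 + (\<chi> i. r / real CARD('n)))"
      using box_bump_outside[OF w] by blast
    then have "\<bar>x $ i\<bar> < r / real CARD('n)" for i by (simp add: mem_box_cart abs_less_iff) (metis minus_less_iff)
    then have "(\<Sum>i\<in>UNIV. \<bar>x $ i\<bar>) < (\<Sum>i\<in>(UNIV::'n set). r / real CARD('n))"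
      by (intro sum_strict_mono) auto
    with norm_le_l1_cart[of x] that show False by simp
  qed
  have e: "?c * exp (- 1) ^ CARD('n) = 1"
    by (simp add: power_mult_distrib[symmetric] exp_minus)
  have z: "?c * ?b 0 = 1" using e by (simp add: box_bump_def bump_def)
  have "smooth (\<lambda>x. ?c * ?b x)"
    using smooth_bdd_cmult[OF test_function_smooth_bdd[OF t], of ?c] by (simp add: smooth_bdd_def)
  moreover have "{x. ?c * ?b x \<noteq> 0} = {x. ?b x \<noteq> 0}" by simp
  ultimately have "test_function (\<lambda>x. ?c * ?b x)"
    using t by (simp add: test_function_def)
  moreover have "0 \<le> ?c * ?b x" "?c * ?b x \<le> 1" for x
    using box_bump_range[of 1 "0 :: real ^ 'n" _ x] e
    using mult_left_mono[of _ _ ?c] by (metis mult_nonneg_nonneg exp_ge_zero zero_le_power zero_less_one)+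
  ultimately show ?thesis using z o
    by (intro exI[of _ "\<lambda>x. ?c * ?b x"]) auto
qed

text \<open>For a = 1/(n+1) tending to 0, exp(-a/(1-t^2)) tends to 1 whenever |t| < 1 and never
  exceeds 1; the indicator itself is then a dominating function.\<close>

lemma test_functions_approach_box:
  fixes l u :: "real ^ 'n::finite"
  assumes lu: "\<And>i. l $ i < u $ i"
  shows "\<exists>\<psi>. (\<forall>n::nat. test_function (\<psi> n)) \<and> (\<forall>n x. 0 \<le> \<psi> n x \<and> \<psi> n x \<le> indicator (box l u) x) \<and>
    (\<forall>x. (\<lambda>n. \<psi> n x) \<longlonglongrightarrow> indicator (box l u) x)"
proof -
  define m where "m = (1/2) *\<^sub>R (l + u)"
  define w where "w = (1/2) *\<^sub>R (u - l)"
  have w: "w $ i > 0" for i using lu[of i] by (simp add: w_def)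
  have mw: "m - w = l" "m + w = u" by (simp_all add: m_def w_def vec_eq_iff field_simps)
  define \<psi> where "\<psi> n = box_bump (1 / Suc n) (\<lambda>_. 1) (\<lambda>_. 0) m w" for n
  have a: "1 / real (Suc n) > 0" for n by simp
  have 1: "test_function (\<psi> n)" for n unfolding \<psi>_def by (rule test_function_box_bump[OF a w])
  have out: "\<psi> n x = 0" if "x \<notin> box l u" for n x
    unfolding \<psi>_def using box_bump_outside[OF w] that mw by metis
  have 2: "0 \<le> \<psi> n x" for n x unfolding \<psi>_def by (rule box_bump_range[OF a])
  have 3: "\<psi> n x \<le> 1" for n x
  proof -
    have "\<psi> n x \<le> exp (- (1 / Suc n)) ^ CARD('n)" unfolding \<psi>_def by (rule box_bump_range[OF a])
    also have "\<dots> \<le> 1" by (intro power_le_one) auto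
    finally show ?thesis .
  qed
  have 4: "(\<lambda>n. \<psi> n x) \<longlonglongrightarrow> 1" if x: "x \<in> box l u" for x
  proof -
    have "(\<lambda>n. bump (1 / Suc n) 1 0 ((x $ i - m $ i) / w $ i)) \<longlonglongrightarrow> 1" for i
    proof -
      have "m $ i - w $ i < x $ i" "x $ i < m $ i + w $ i"
        using x mw by (auto simp: mem_box_cart vector_minus_component[symmetric] vector_add_component[symmetric]
          simp del: vector_minus_component vector_add_component)
      then have t: "\<bar>(x $ i - m $ i) / w $ i\<bar> < 1" using w[of i] by (auto simp: abs_less_iff field_simps)
      have "(\<lambda>n. exp (- (1 / Suc n) * inverse (1 - ((x $ i - m $ i) / w $ i)\<^sup>2))) \<longlonglongrightarrow>
         exp (- 0 * inverse (1 - ((x $ i - m $ i) / w $ i)\<^sup>2))"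
        by (intro tendsto_intros LIMSEQ_Suc[OF lim_1_over_n])
      then show ?thesis using t by (simp add: bump_def)
    qed
    then have "(\<lambda>n. \<psi> n x) \<longlonglongrightarrow> (\<Prod>i\<in>(UNIV::'n set). 1)"
      unfolding \<psi>_def box_bump_def by (intro tendsto_prod)
    then show ?thesis by simp
  qed
  show ?thesis
    by (rule exI[of _ \<psi>]) (use 1 2 3 4 out in \<open>auto simp: indicator_def\<close>)
qed

section \<open>Linearity of the operators\<close>

text \<open>The index set is a parameter because the coupling argument removes one diffusion
  direction.\<close>

definition sum_op :: "'j set \<Rightarrow> ('j \<Rightarrow> real ^ 'n::finite) \<Rightarrow> real ^ 'n \<Rightarrow> (real ^ 'n \<Rightarrow> real) \<Rightarrow> real ^ 'n \<Rightarrow> real" where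
  "sum_op J s b f x = (\<Sum>j\<in>J. ddir (s j) (ddir (s j) f) x) + b \<bullet> gradient f x"

lemma local_op_sum_op:
  "smooth_bdd f \<Longrightarrow> local_op \<sigma> b f x = sum_op UNIV (\<lambda>j. column j \<sigma>) b f x"
  by (simp add: local_op_eq sum_op_def)

lemma sum_op_add:
  "smooth_bdd f \<Longrightarrow> smooth_bdd g \<Longrightarrow> sum_op J s b (\<lambda>x. f x + g x) x = sum_op J s b f x + sum_op J s b g x"
  by (simp add: sum_op_def ddir_add ddir_smooth_bdd gradient_add sum.distrib inner_add_right)

lemma sum_op_cmult:
  "smooth_bdd f \<Longrightarrow> sum_op J s b (\<lambda>x. c * f x) x = c * sum_op J s b f x"
  by (simp add: sum_op_def ddir_cmult ddir_smooth_bdd gradient_cmult sum_distrib_left distrib_left)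

lemma sum_op_shift:
  "smooth_bdd f \<Longrightarrow> sum_op J s b (\<lambda>x. f (x + a)) x = sum_op J s b f (x + a)"
  by (simp add: sum_op_def ddir_shift ddir_smooth_bdd gradient_shift)

lemma sum_op_bound:
  assumes "smooth_bdd f"
  shows "\<exists>C\<ge>0. \<forall>x. \<bar>sum_op J s b f x\<bar> \<le> C"
proof -
  have "smooth_bdd (\<lambda>x. (\<Sum>j\<in>J. ddir (s j) (ddir (s j) f) x) + ddir b f x)"
    by (intro smooth_bdd_add smooth_bdd_sum ddir_smooth_bdd assms)
  from smooth_bdd_bound[OF this] show ?thesis by (simp add: sum_op_def ddir_def)
qed

section \<open>The integrand of the nonlocal operator\<close>

definition jump :: "(real ^ 'n::finite \<Rightarrow> real) \<Rightarrow> real ^ 'n \<Rightarrow> real ^ 'n \<Rightarrow> real" where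
  "jump f x z = f (x + z) - f x - z \<bullet> gradient f x * indicator {z. norm z \<le> 1} z"

lemma nonlocal_op_jump: "nonlocal_op \<mu> f x = (LINT z|\<mu>. jump f x z)"
  by (simp add: nonlocal_op_def jump_def)

text \<open>In the unit ball the compensated difference is a second order Taylor remainder; outside
  there is no compensator and twice the bound on \<open>f\<close> suffices. The result matches the
  integrability condition on \<mu>.\<close>

lemma jump_bound:
  assumes "smooth_bdd f"
  shows "\<exists>K\<ge>0. \<forall>x z. \<bar>jump f x z\<bar> \<le> K * min ((norm z)\<^sup>2) 1"
proof -
  obtain C where C: "C \<ge> 0" "\<And>x z. \<bar>f (x + z) - f x - z \<bullet> gradient f x\<bar> \<le> C * (norm z)\<^sup>2"
    using taylor2[OF assms] by blast
  obtain A where A: "A \<ge> 0" "\<And>x. \<bar>f x\<bar> \<le> A" using smooth_bdd_bound[OF assms] by blast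
  have "\<bar>jump f x z\<bar> \<le> (C + 2 * A) * min ((norm z)\<^sup>2) 1" for x z
  proof (cases "norm z \<le> 1")
    case True
    then have "min ((norm z)\<^sup>2) 1 = (norm z)\<^sup>2" by (simp add: abs_square_le_1)
    moreover have "C * (norm z)\<^sup>2 \<le> (C + 2 * A) * (norm z)\<^sup>2" using A(1) by (intro mult_right_mono) auto
    ultimately show ?thesis using C(2)[of x z] True by (simp add: jump_def)
  next
    case False
    then have "min ((norm z)\<^sup>2) 1 = 1" by (simp add: one_le_power)
    then show ?thesis using A(2)[of "x + z"] A(2)[of x] C(1) False by (simp add: jump_def abs_le_iff)
  qed
  then show ?thesis using C(1) A(1) by (intro exI[of _ "C + 2 * A"]) auto
qed

definition periods :: "('a::real_normed_vector \<Rightarrow> real) \<Rightarrow> 'a set" where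
  "periods f = {h. \<forall>x. f (x + h) = f x}"

locale levy =
  fixes \<mu> :: "(real ^ 'n::finite) measure"
  assumes levy: "levy_measure \<mu>"
begin

lemma sets_mu: "sets \<mu> = sets (restrict_space borel (- {0}))"
  using levy by (simp add: levy_measure_def radon_measure_on_def)

lemma space_mu: "space \<mu> = - {0}"
  using sets_eq_imp_space_eq[OF sets_mu] by (simp add: space_restrict_space)

lemma in_sets_mu: "A \<in> sets borel \<Longrightarrow> 0 \<notin> A \<Longrightarrow> A \<in> sets \<mu>"
  by (auto simp: sets_mu sets_restrict_space)

lemma measurable_mu: "f \<in> borel_measurable borel \<Longrightarrow> f \<in> borel_measurable \<mu>"
  unfolding measurable_cong_sets[OF sets_mu refl] by (rule measurable_restrict_space1)

lemma integrable_min: "integrable \<mu> (\<lambda>z. min ((norm z)\<^sup>2) 1)"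
proof (rule integrableI_bounded)
  show "(\<integral>\<^sup>+ z. ennreal (norm (min ((norm z)\<^sup>2) 1 :: real)) \<partial>\<mu>) < \<infinity>"
    using levy by (simp add: levy_measure_def)
qed (intro measurable_mu, measurable)

lemma jump_measurable: "smooth_bdd f \<Longrightarrow> jump f x \<in> borel_measurable borel"
proof -
  assume "smooth_bdd f"
  note [measurable] = smooth_bdd_borel[OF this]
  have [measurable]: "{z::real^'n. norm z \<le> 1} \<in> sets borel" by simp
  show "jump f x \<in> borel_measurable borel" unfolding jump_def[abs_def] by measurable
qed

lemma jump_integrable:
  assumes "smooth_bdd f"
  shows "integrable \<mu> (jump f x)"
proof -
  obtain K where "\<And>x z. \<bar>jump f x z\<bar> \<le> K * min ((norm z)\<^sup>2) 1" "K \<ge> 0" using jump_bound[OF assms] by blast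
  then show ?thesis
    by (intro Bochner_Integration.integrable_bound[OF integrable_mult_right[OF integrable_min, of K]]
      measurable_mu jump_measurable assms) auto
qed

lemma full_op_add:
  assumes "smooth_bdd f" "smooth_bdd g"
  shows "full_op \<sigma> b \<mu> (\<lambda>x. f x + g x) x = full_op \<sigma> b \<mu> f x + full_op \<sigma> b \<mu> g x"
proof -
  have "jump (\<lambda>x. f x + g x) x = (\<lambda>z. jump f x z + jump g x z)"
    using assms by (simp add: jump_def fun_eq_iff gradient_add algebra_simps)
  then show ?thesis
    using assms by (simp add: full_op_def local_op_sum_op smooth_bdd_add sum_op_add nonlocal_op_jump jump_integrable)
qed

lemma full_op_cmult:
  assumes "smooth_bdd f"
  shows "full_op \<sigma> b \<mu> (\<lambda>x. c * f x) x = c * full_op \<sigma> b \<mu> f x"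
proof -
  have "jump (\<lambda>x. c * f x) x = (\<lambda>z. c * jump f x z)"
    using assms by (simp add: jump_def fun_eq_iff gradient_cmult algebra_simps)
  then show ?thesis
    using assms by (simp add: full_op_def local_op_sum_op smooth_bdd_cmult sum_op_cmult nonlocal_op_jump distrib_left)
qed

lemma full_op_shift:
  assumes "smooth_bdd f"
  shows "full_op \<sigma> b \<mu> (\<lambda>x. f (x + a)) x = full_op \<sigma> b \<mu> f (x + a)"
proof -
  have "jump (\<lambda>x. f (x + a)) x = jump f (x + a)"
    using assms by (simp add: jump_def fun_eq_iff gradient_shift algebra_simps)
  then show ?thesis
    using assms by (simp add: full_op_def local_op_sum_op smooth_bdd_shift sum_op_shift nonlocal_op_jump)
qed

lemma full_op_bound:
  assumes "smooth_bdd f"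
  shows "\<exists>C\<ge>0. \<forall>x. \<bar>full_op \<sigma> b \<mu> f x\<bar> \<le> C"
proof -
  obtain K where K: "\<And>x z. \<bar>jump f x z\<bar> \<le> K * min ((norm z)\<^sup>2) 1" "K \<ge> 0" using jump_bound[OF assms] by blast
  obtain A where A: "A \<ge> 0" "\<And>x. \<bar>sum_op UNIV (\<lambda>j. column j \<sigma>) b f x\<bar> \<le> A" using sum_op_bound[OF assms] by blast
  have "norm (LINT z|\<mu>. jump f x z) \<le> (LINT z|\<mu>. K * min ((norm z)\<^sup>2) 1)" for x
    using K(1) by (intro Bochner_Integration.integral_norm_bound_integral jump_integrable assms
      integrable_mult_right integrable_min) auto
  from this[unfolded real_norm_def] have "\<bar>full_op \<sigma> b \<mu> f x\<bar> \<le> A + \<bar>LINT z|\<mu>. K * min ((norm z)\<^sup>2) 1\<bar>" for x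
    unfolding full_op_def local_op_sum_op[OF assms] nonlocal_op_jump
    by (intro order_trans[OF abs_triangle_ineq] add_mono A(2)) (rule order_trans, assumption, rule abs_ge_self)
  then show ?thesis using A(1) by (intro exI[of _ "A + \<bar>LINT z|\<mu>. K * min ((norm z)\<^sup>2) 1\<bar>"]) auto
qed

section \<open>Periodicity along the support of the jump measure\<close>

text \<open>
  At a maximum of a small smooth perturbation of \<open>v\<close>, the local part of the operator is nonpositive
  and the gradient vanishes, so the jump part cannot be very negative.
\<close>

lemma near_max_propagates:
  assumes v: "smooth_bdd v" and eq: "\<And>x. full_op \<sigma> b \<mu> v x = 0" and M: "\<And>x. v x \<le> M"
    and g: "g \<in> msupp \<mu>" and \<epsilon>: "\<epsilon> > 0"
  shows "\<exists>\<delta>>0. \<forall>x. v x \<ge> M - \<delta> \<longrightarrow> v (x + g) \<ge> M - \<epsilon>"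
proof -
  obtain K where K: "K \<ge> 0" "\<And>x y. \<bar>v x - v y\<bar> \<le> K * norm (x - y)" using smooth_bdd_lipschitz[OF v] by blast
  \<comment> \<open>Over the distance \<open>2 * r\<close> the function \<open>v\<close> changes by
    at most \<open>\<epsilon> / 2\<close>.\<close>
  define r where "r = \<epsilon> / (4 * (K + 1))"
  have r: "r > 0" using K(1) \<epsilon> by (simp add: r_def)
  have Kr: "2 * K * r \<le> \<epsilon> / 2" using K(1) \<epsilon> by (simp add: r_def field_simps)
  obtain \<eta> :: "real ^ 'n \<Rightarrow> real" where \<eta>: "test_function \<eta>" "\<eta> 0 = 1" "\<And>x. 0 \<le> \<eta> x" "\<And>x. \<eta> x \<le> 1"
    "\<And>x. norm x \<ge> r \<Longrightarrow> \<eta> x = 0" using exists_bump[OF r] by blast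
  note \<eta>s = test_function_smooth_bdd[OF \<eta>(1)]
  obtain C where C: "C \<ge> 0" "\<And>x. \<bar>full_op \<sigma> b \<mu> \<eta> x\<bar> \<le> C" using full_op_bound[OF \<eta>s] by blast
  define B where "B = ball g r - {0}"
  have Bs: "B \<in> sets \<mu>" unfolding B_def by (rule in_sets_mu) auto
  have Bp: "emeasure \<mu> B > 0" using g r by (simp add: msupp_def B_def)
  \<comment> \<open>Truncated at 1, since the ball may reach to 0, where \<mu> can have infinite
    mass.\<close>
  define m where "m = enn2real (min (emeasure \<mu> B) 1)"
  have mf: "min (emeasure \<mu> B) 1 < \<infinity>" by (simp add: min_less_iff_disj)
  have m: "m > 0" "ennreal m \<le> emeasure \<mu> B"
    using Bp mf by (simp_all add: m_def enn2real_positive_iff)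
  \<comment> \<open>The first bound keeps the drop of the perturbed function on \<open>B\<close> at
    least \<open>\<epsilon> / 4\<close>; with the second, Markov's inequality gives the absurd
    \<open>m \<le> m * (C / (2 * (C + 1)))\<close>.\<close>
  define \<delta> where "\<delta> = min (\<epsilon> / 4) (\<epsilon> * m / (16 * (C + 1)))"
  have "\<epsilon> * m / (16 * (C + 1)) > 0" using \<epsilon> m(1) C(1) by (intro divide_pos_pos mult_pos_pos) auto
  then have \<delta>: "\<delta> > 0" "\<delta> \<le> \<epsilon> / 4" "\<delta> \<le> \<epsilon> * m / (16 * (C + 1))" using \<epsilon> unfolding \<delta>_def by linarith+
  have "v (x + g) \<ge> M - \<epsilon>" if x: "v x \<ge> M - \<delta>" for x
  proof (rule ccontr)
    assume "\<not> v (x + g) \<ge> M - \<epsilon>"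
    then have xg: "v (x + g) < M - \<epsilon>" by simp
    \<comment> \<open>The bump lifts the value at \<open>x\<close> to at least
      \<open>M + \<delta>\<close>, whereas outside \<open>cball x r\<close> nothing exceeds
      \<open>M\<close>; the maximum over this ball is global.\<close>
    define W where "W y = v y + 2 * \<delta> * \<eta> (y + (- x))" for y
    have Ws: "smooth_bdd W" unfolding W_def[abs_def] by (intro smooth_bdd_add smooth_bdd_cmult v smooth_bdd_shift \<eta>s)
    have Wx: "W x \<ge> M + \<delta>" using x \<eta>(2) by (simp add: W_def)
    have "\<exists>y\<in>cball x r. \<forall>z\<in>cball x r. W z \<le> W y"
      using r by (intro continuous_attains_sup smooth_bdd_continuous Ws) auto
    then obtain y where y: "y \<in> cball x r" "\<And>z. z \<in> cball x r \<Longrightarrow> W z \<le> W y" by blast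
    have Wy: "W y \<ge> M + \<delta>" using y(2)[of x] Wx r by auto
    have max: "W z \<le> W y" for z
    proof (cases "z \<in> cball x r")
      case False
      then have "\<eta> (z + (- x)) = 0" by (intro \<eta>(5)) (simp add: dist_norm norm_minus_commute)
      then show ?thesis using M[of z] Wy \<delta> by (simp add: W_def)
    qed (rule y(2))
    have grad: "gradient W y = 0" by (rule smooth_bdd_max(1)[OF Ws max])
    have "full_op \<sigma> b \<mu> W y = full_op \<sigma> b \<mu> v y + 2 * \<delta> * full_op \<sigma> b \<mu> \<eta> (y + (- x))"
      unfolding W_def[abs_def]
      by (simp only: full_op_add full_op_cmult full_op_shift v smooth_bdd_cmult smooth_bdd_shift \<eta>s)
    then have 1: "full_op \<sigma> b \<mu> W y \<ge> - (2 * \<delta> * C)"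
      using eq[of y] C(2)[of "y + (- x)"] \<delta>(1) mult_left_mono[of "- C" "full_op \<sigma> b \<mu> \<eta> (y + (- x))" "2 * \<delta>"]
      by (simp only: abs_le_iff) linarith
    have "sum_op UNIV (\<lambda>j. column j \<sigma>) b W y \<le> 0"
      using smooth_bdd_max(2)[OF Ws max] grad by (simp add: sum_op_def sum_nonpos)
    with 1 have 2: "nonlocal_op \<mu> W y \<ge> - (2 * \<delta> * C)" by (simp add: full_op_def local_op_sum_op Ws)
    define F where "F z = W y - W (y + z)" for z
    have jF: "jump W y = (\<lambda>z. - F z)" by (simp add: jump_def F_def grad fun_eq_iff)
    have Fi: "integrable \<mu> F" using jump_integrable[OF Ws, of y] unfolding jF by simp
    have F0: "0 \<le> F z" for z using max by (simp add: F_def)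
    have IF: "(LINT z|\<mu>. F z) \<le> 2 * \<delta> * C" using 2 by (simp add: nonlocal_op_jump jF)
    have FB: "\<epsilon> / 4 \<le> F z" if "z \<in> B" for z
    proof -
      have "norm (y + z - (x + g)) \<le> norm (y - x) + norm (z - g)"
        using norm_triangle_ineq[of "y - x" "z - g"] by (simp add: algebra_simps)
      also have "\<dots> \<le> r + r" using y(1) that by (intro add_mono) (auto simp: B_def dist_norm norm_minus_commute)
      finally have "K * norm (y + z - (x + g)) \<le> K * (2 * r)" using K(1) by (intro mult_left_mono) auto
      then have "v (y + z) \<le> v (x + g) + 2 * K * r" using K(2)[of "y + z" "x + g"] by (simp add: abs_le_iff mult_ac)
      moreover have "2 * \<delta> * \<eta> (y + z + (- x)) \<le> 2 * \<delta>" using \<eta>(4) \<delta>(1) by simp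
      ultimately have "W (y + z) \<le> M - \<epsilon> + 2 * K * r + 2 * \<delta>" using xg by (simp add: W_def)
      then show ?thesis using Wy Kr \<delta>(2) by (simp add: F_def)
    qed
    have "ennreal m \<le> emeasure \<mu> B" by (rule m)
    also have "\<dots> \<le> emeasure \<mu> {z\<in>space \<mu>. F z \<ge> \<epsilon> / 4}"
      using FB sets.sets_into_space[OF Bs] Fi by (intro emeasure_mono) auto
    also have "\<dots> \<le> ennreal (1 / (\<epsilon> / 4) * (LINT z|\<mu>. F z))"
      using \<epsilon> F0 by (intro integral_Markov_inequality Fi) auto
    finally have "m \<le> 1 / (\<epsilon> / 4) * (LINT z|\<mu>. F z)"
      using \<epsilon> F0 by (subst (asm) ennreal_le_iff) (auto intro!: divide_nonneg_nonneg integral_nonneg_AE)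
    also have "\<dots> \<le> 1 / (\<epsilon> / 4) * (2 * (\<epsilon> * m / (16 * (C + 1))) * C)"
      using \<delta>(3) C(1) \<epsilon> by (intro mult_left_mono order_trans[OF IF] mult_right_mono) auto
    also have "\<dots> = m * (C / (2 * (C + 1)))" using \<epsilon> C(1) by (simp add: field_simps)
    also have "\<dots> < m * 1" using m(1) C(1) by (intro mult_strict_left_mono) (auto simp: field_simps)
    finally show False by simp
  qed
  with \<delta>(1) show ?thesis by blast
qed

text \<open>The tolerance is chosen backwards: the first \<open>N\<close> steps must stay within the
  tolerance \<open>\<delta>1\<close> that the last step needs.\<close>

lemma near_max_propagates_iterated:
  assumes v: "smooth_bdd v" and eq: "\<And>x. full_op \<sigma> b \<mu> v x = 0" and M: "\<And>x. v x \<le> M"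
    and g: "g \<in> msupp \<mu>" and \<epsilon>: "\<epsilon> > 0"
  shows "\<exists>\<delta>>0. \<forall>x. v x \<ge> M - \<delta> \<longrightarrow> (\<forall>k\<le>N. v (x + real k *\<^sub>R g) \<ge> M - \<epsilon>)"
  using \<epsilon>
proof (induction N arbitrary: \<epsilon>)
  case 0
  then show ?case by (intro exI[of _ \<epsilon>]) auto
next
  case (Suc N)
  obtain \<delta>1 where d1: "\<delta>1 > 0" "\<And>x. v x \<ge> M - \<delta>1 \<Longrightarrow> v (x + g) \<ge> M - \<epsilon>"
    using near_max_propagates[OF v eq M g Suc.prems] by blast
  obtain \<delta> where d: "\<delta> > 0" "\<And>x k. v x \<ge> M - \<delta> \<Longrightarrow> k \<le> N \<Longrightarrow> v (x + real k *\<^sub>R g) \<ge> M - min \<epsilon> \<delta>1"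
    using Suc.IH[of "min \<epsilon> \<delta>1"] Suc.prems d1(1) by auto
  have "v (x + real k *\<^sub>R g) \<ge> M - \<epsilon>" if x: "v x \<ge> M - \<delta>" and k: "k \<le> Suc N" for x k
  proof (cases "k \<le> N")
    case True
    then show ?thesis using d(2)[OF x True] by auto
  next
    case False
    then have "k = Suc N" using k by simp
    then show ?thesis using d1(2)[of "x + real N *\<^sub>R g"] d(2)[OF x, of N] by (auto simp: algebra_simps)
  qed
  with d(1) show ?case by blast
qed

lemma support_translation_le:
  assumes f: "smooth_bdd f" and eq: "\<And>x. full_op \<sigma> b \<mu> f x = 0" and g: "g \<in> msupp \<mu>"
  shows "f (x + g) \<le> f x"
proof (rule ccontr)
  assume neg: "\<not> f (x + g) \<le> f x"
  obtain C where C: "C \<ge> 0" "\<And>x. \<bar>f x\<bar> \<le> C" using smooth_bdd_bound[OF f] by blast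
  define v where "v y = f (y + g) + (- 1) * f y" for y
  have vs: "smooth_bdd v" unfolding v_def[abs_def] by (intro smooth_bdd_add smooth_bdd_cmult smooth_bdd_shift f)
  have veq: "full_op \<sigma> b \<mu> v y = 0" for y
    unfolding v_def[abs_def] by (simp only: full_op_add full_op_cmult full_op_shift smooth_bdd_cmult smooth_bdd_shift f eq mult_zero_right add_0_right)
  define M where "M = (SUP y. v y)"
  have bdd: "bdd_above (range v)"
    using smooth_bdd_bound[OF vs] by (auto simp: bdd_above_def abs_le_iff)
  have vM: "v y \<le> M" for y unfolding M_def by (rule cSUP_upper[OF _ bdd]) simp
  have "v x > 0" using neg by (simp add: v_def)
  then have M0: "M > 0" using vM[of x] by simp
  \<comment> \<open>\<open>N\<close> increments of at least \<open>M / 2\<close> exceed the possible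
    oscillation \<open>2 * C\<close> of \<open>f\<close>. \<open>N\<close> is fixed before
    \<open>y\<close>, as \<delta> depends on it.\<close>
  obtain N :: nat where N: "2 * C < real N * (M / 2)"
    using reals_Archimedean3[of "M / 2"] M0 by (meson half_gt_zero)
  obtain \<delta> where d: "\<delta> > 0" "\<And>x k. v x \<ge> M - \<delta> \<Longrightarrow> k \<le> N \<Longrightarrow> v (x + real k *\<^sub>R g) \<ge> M - M / 2"
    using near_max_propagates_iterated[OF vs veq vM g, of "M / 2" N] M0 by auto
  have "\<exists>y\<in>UNIV. M - \<delta> < v y"
    using less_cSUP_iff[OF _ bdd, of "M - \<delta>"] d(1) by (auto simp: M_def)
  then obtain y where "M - \<delta> < v y" by blast
  then have y: "v y \<ge> M - \<delta>" by simp
  have "real N * (M / 2) = (\<Sum>k<N. M / 2)" by simp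
  also have "\<dots> \<le> (\<Sum>k<N. v (y + real k *\<^sub>R g))"
    using d(2)[OF y] by (intro sum_mono) auto
  also have "\<dots> = (\<Sum>k<N. f (y + real (Suc k) *\<^sub>R g) - f (y + real k *\<^sub>R g))"
    by (intro sum.cong) (auto simp: v_def algebra_simps)
  also have "\<dots> = f (y + real N *\<^sub>R g) - f (y + real 0 *\<^sub>R g)" by (rule sum_lessThan_telescope)
  also have "\<dots> \<le> 2 * C" using C(2)[of "y + real N *\<^sub>R g"] C(2)[of y] by auto
  finally show False using N by simp
qed

lemma support_subset_periods:
  assumes f: "smooth_bdd f" and eq: "\<And>x. full_op \<sigma> b \<mu> f x = 0"
  shows "msupp \<mu> \<subseteq> periods f"
proof
  fix g assume g: "g \<in> msupp \<mu>"
  have "full_op \<sigma> b \<mu> (\<lambda>x. (- 1) * f x) x = 0" for x by (simp only: full_op_cmult f eq mult_zero_right add_0_right)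
  from support_translation_le[OF smooth_bdd_cmult[OF f] this g] support_translation_le[OF f eq g]
  show "g \<in> periods f" by (auto simp: periods_def intro: antisym)
qed

end

section \<open>The closed group of periods\<close>

lemma zero_periods: "0 \<in> periods f"
  by (simp add: periods_def)

lemma diff_periods: "g \<in> periods f \<Longrightarrow> h \<in> periods f \<Longrightarrow> g - h \<in> periods f"
  unfolding periods_def
proof (intro CollectI allI; elim CollectE)
  fix x assume "\<forall>x. f (x + g) = f x" "\<forall>x. f (x + h) = f x"
  then have "f (x + (g - h) + h) = f (x + (g - h))" "f (x + g) = f x" by blast+
  then show "f (x + (g - h)) = f x" by simp
qed

lemma add_periods: "g \<in> periods f \<Longrightarrow> h \<in> periods f \<Longrightarrow> g + h \<in> periods f"
  by (simp add: periods_def add.assoc[symmetric])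

lemma closed_periods:
  assumes "continuous_on UNIV f"
  shows "closed (periods f)"
proof -
  have "closed {h. f (x + h) = f x}" for x
    by (intro closed_Collect_eq continuous_intros continuous_on_compose2[OF assms]) auto
  then have "closed (\<Inter>x. {h. f (x + h) = f x})" by blast
  moreover have "(\<Inter>x. {h. f (x + h) = f x}) = periods f" by (auto simp: periods_def)
  ultimately show ?thesis by simp
qed

lemma group_closure_subset_periods:
  assumes "S \<subseteq> periods f"
  shows "group_closure S \<subseteq> periods f"
proof
  fix g assume "g \<in> group_closure S"
  then show "g \<in> periods f"
    by (induction rule: group_closure.induct) (use assms zero_periods diff_periods in auto)
qed

lemma gradient_orthogonal_periods:
  assumes f: "smooth_bdd f" and v: "\<And>t::real. t *\<^sub>R v \<in> periods f"
  shows "v \<bullet> gradient f x = 0"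
proof -
  have "((\<lambda>t. f (x + t *\<^sub>R v)) has_real_derivative 0) (at 0)"
    using v by (simp add: periods_def)
  from DERIV_unique[OF this ddir_line[OF f]] show ?thesis by (simp add: ddir_def)
qed

section \<open>Closed subgroups\<close>

lemma G_of_group:
  shows "0 \<in> G_of \<mu>" and "g \<in> G_of \<mu> \<Longrightarrow> h \<in> G_of \<mu> \<Longrightarrow> g - h \<in> G_of \<mu>"
proof -
  show "0 \<in> G_of \<mu>" unfolding G_of_def using closure_subset zero_in_group_closure by blast
  assume "g \<in> G_of \<mu>" "h \<in> G_of \<mu>"
  then obtain a b where "\<And>n. a n \<in> group_closure (msupp \<mu>)" "a \<longlonglongrightarrow> g"
    "\<And>n. b n \<in> group_closure (msupp \<mu>)" "b \<longlonglongrightarrow> h"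
    unfolding G_of_def closure_sequential by blast
  then have "\<forall>n. a n - b n \<in> group_closure (msupp \<mu>)" "(\<lambda>n. a n - b n) \<longlonglongrightarrow> g - h"
    by (auto intro: group_closure.diff tendsto_diff)
  then show "g - h \<in> G_of \<mu>" unfolding G_of_def closure_sequential
    by (intro exI[of _ "\<lambda>n. a n - b n"] conjI)
qed

lemma scaleR_int_mem_group:
  fixes G :: "'a::real_vector set"
  assumes "0 \<in> G" "\<And>g h. g \<in> G \<Longrightarrow> h \<in> G \<Longrightarrow> g - h \<in> G" "w \<in> G"
  shows "real_of_int k *\<^sub>R w \<in> G"
proof (induction k rule: int_induct[where k=0])
  case (step1 i)
  have "0 - w \<in> G" using assms by blast
  with step1 have "real_of_int i *\<^sub>R w - (0 - w) \<in> G" using assms by blast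
  then show ?case by (simp add: algebra_simps)
next
  case (step2 i)
  then have "real_of_int i *\<^sub>R w - w \<in> G" using assms by blast
  then show ?case by (simp add: algebra_simps)
qed (use assms in auto)

text \<open>
  Otherwise the components orthogonal to the largest subspace \<open>V\<close> of short elements outside
  of it accumulate, after normalisation, at a unit vector all of whose multiples lie in the group.
\<close>

lemma closed_subgroup_gap:
  fixes G :: "'a::euclidean_space set"
  assumes cl: "closed G" and z: "0 \<in> G" and d: "\<And>g h. g \<in> G \<Longrightarrow> h \<in> G \<Longrightarrow> g - h \<in> G"
  defines "V \<equiv> {g \<in> G. \<forall>t::real. t *\<^sub>R g \<in> G}"
  shows "\<exists>e>0. \<forall>g\<in>G. norm g < e \<longrightarrow> g \<in> V"
proof (rule ccontr)
  assume "\<not> ?thesis"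
  then have "\<forall>n::nat. \<exists>g\<in>G. norm g < 1 / Suc n \<and> g \<notin> V" by (metis of_nat_0_less_iff zero_less_Suc zero_less_divide_1_iff)
  then obtain g where g: "\<And>n. g n \<in> G" "\<And>n. norm (g n) < 1 / Suc n" "\<And>n. g n \<notin> V" by metis
  have add: "a + b \<in> G" if "a \<in> G" "b \<in> G" for a b
    using d[OF that(1) d[OF z that(2)]] by simp
  have sV: "subspace V"
    unfolding subspace_def V_def using z add by (auto simp: scaleR_add_right)
  have "\<exists>v w. v \<in> V \<and> (\<forall>u\<in>V. orthogonal w u) \<and> g n = v + w" for n
    using orthogonal_subspace_decomp_exists[of V "g n"] span_eq_iff[of V] sV by metis
  then obtain v w where v: "\<And>n. v n \<in> V" and w: "\<And>n u. u \<in> V \<Longrightarrow> orthogonal (w n) u"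
    and gvw: "\<And>n. g n = v n + w n" by metis
  \<comment> \<open>The part removed from \<open>g n\<close> lies in \<open>V\<close>, hence in the
    group.\<close>
  have wG: "w n \<in> G" for n
  proof -
    have "g n - v n \<in> G" using g(1) v d by (auto simp: V_def)
    then show ?thesis by (simp add: gvw)
  qed
  have w0: "w n \<noteq> 0" for n using g(3)[of n] v[of n] by (auto simp: gvw)
  have wn: "norm (w n) < 1 / Suc n" for n
  proof -
    have "(norm (g n))\<^sup>2 = (norm (v n))\<^sup>2 + (norm (w n))\<^sup>2"
      unfolding gvw by (rule norm_add_Pythagorean) (use w[OF v] orthogonal_commute in blast)
    then have "(norm (w n))\<^sup>2 \<le> (norm (g n))\<^sup>2" using zero_le_power2[of "norm (v n)"] by linarith
    then have "norm (w n) \<le> norm (g n)" by (rule power2_le_imp_le) simp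
    with g(2)[of n] show ?thesis by simp
  qed
  have wlim: "(\<lambda>n. norm (w n)) \<longlonglongrightarrow> 0"
    by (rule Lim_null_comparison[OF _ LIMSEQ_Suc[OF lim_1_over_n]]) (use wn in \<open>auto intro!: always_eventually less_imp_le\<close>)
  define u where "u n = sgn (w n)" for n
  have "\<forall>n. u n \<in> sphere 0 1" using w0 by (simp add: u_def norm_sgn)
  then obtain e r where e: "e \<in> sphere 0 1" and r: "strict_mono r" "(u \<circ> r) \<longlonglongrightarrow> e"
    using compact_sphere[of "0::'a" 1] unfolding compact_def by metis
  have te: "t *\<^sub>R e \<in> G" for t :: real
  proof -
    \<comment> \<open>Integer multiples of the short vector \<open>w (r n)\<close> come within
      \<open>norm (w (r n))\<close> of \<open>t *\<^sub>R u (r n)\<close>, so they tend to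
      \<open>t *\<^sub>R e\<close>, which is in \<open>G\<close> by closedness.\<close>
    define a where "a n = real_of_int \<lfloor>t / norm (w (r n))\<rfloor> *\<^sub>R w (r n)" for n
    have aG: "a n \<in> G" for n unfolding a_def by (rule scaleR_int_mem_group[OF z d wG])
    have "norm (a n - t *\<^sub>R u (r n)) \<le> norm (w (r n))" for n
    proof -
      have "a n - t *\<^sub>R u (r n) = (real_of_int \<lfloor>t / norm (w (r n))\<rfloor> - t / norm (w (r n))) *\<^sub>R w (r n)"
        by (simp add: a_def u_def sgn_div_norm scaleR_left_diff_distrib divide_inverse)
      moreover have "\<bar>real_of_int \<lfloor>t / norm (w (r n))\<rfloor> - t / norm (w (r n))\<bar> \<le> 1" by linarith
      ultimately show ?thesis by (simp add: mult_left_le_one_le)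
    qed
    then have "(\<lambda>n. a n - t *\<^sub>R u (r n)) \<longlonglongrightarrow> 0"
      by (intro Lim_null_comparison[OF _ LIMSEQ_subseq_LIMSEQ[OF wlim r(1)]]) auto
    moreover have "(\<lambda>n. t *\<^sub>R u (r n)) \<longlonglongrightarrow> t *\<^sub>R e" using r(2) by (auto intro!: tendsto_intros simp: o_def)
    ultimately have "(\<lambda>n. (a n - t *\<^sub>R u (r n)) + t *\<^sub>R u (r n)) \<longlonglongrightarrow> 0 + t *\<^sub>R e" by (rule tendsto_add)
    then have "a \<longlonglongrightarrow> t *\<^sub>R e" by simp
    with cl aG show ?thesis by (metis closed_sequentially)
  qed
  have "e \<in> V" using te[of 1] te by (simp add: V_def)
  \<comment> \<open>Every \<open>u n\<close> is orthogonal to \<open>V\<close>, which contains the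
    unit vector \<open>e\<close> that a subsequence converges to: a contradiction.\<close>
  then have "u n \<bullet> e = 0" for n using w[of e n] by (simp add: u_def sgn_div_norm orthogonal_def)
  moreover have "(\<lambda>n. (u \<circ> r) n \<bullet> e) \<longlonglongrightarrow> e \<bullet> e" by (intro tendsto_intros r)
  ultimately have "e \<bullet> e = 0" by (simp add: LIMSEQ_const_iff)
  with e show False by simp
qed

section \<open>The drift correction and the reduction to a local operator\<close>

context levy
begin

text \<open>A nonzero point outside the support has a null ball around it, and by Lindelof countably
  many such balls cover all these points.\<close>

lemma AE_msupp: "AE z in \<mu>. z \<in> msupp \<mu>"
proof -
  define F where "F = {ball z r - {0} | z r. r > 0 \<and> emeasure \<mu> (ball z r - {0 :: real ^ 'n}) = 0}"
  have "\<And>S. S \<in> F \<Longrightarrow> open S" by (auto simp: F_def)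
  then obtain F' where F': "F' \<subseteq> F" "countable F'" "\<Union>F' = \<Union>F" by (rule Lindelof)
  have "B \<in> null_sets \<mu>" if "B \<in> F" for B
    using that by (auto simp: F_def null_sets_def intro!: in_sets_mu)
  then have "\<Union>F' \<in> null_sets \<mu>" using F'(1,2) null_sets_UN'[of F' "\<lambda>x. x" \<mu>] by auto
  moreover have "{z\<in>space \<mu>. z \<notin> msupp \<mu>} \<subseteq> \<Union>F"
  proof
    fix z assume "z \<in> {z\<in>space \<mu>. z \<notin> msupp \<mu>}"
    then obtain r where "z \<noteq> 0" "r > 0" "emeasure \<mu> (ball z r - {0}) = 0"
      by (auto simp: space_mu msupp_def)
    then show "z \<in> \<Union>F" unfolding F_def by (intro UnionI[of "ball z r - {0}"]) auto
  qed
  ultimately show ?thesis unfolding F'(3) by (rule AE_I')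
qed

lemma msupp_subset_G_of: "msupp \<mu> \<subseteq> G_of \<mu>"
  unfolding G_of_def using closure_subset[of "group_closure (msupp \<mu>)"] group_closure.base[of _ "msupp \<mu>"] by auto

text \<open>An intersection of closed preimages of \<open>G_of \<mu>\<close>, one for each
  \<open>t\<close>. It makes the domain of integration in \<open>c_of\<close> measurable.\<close>

lemma closed_V_of: "closed (V_of \<mu>)"
proof -
  have "V_of \<mu> = (\<Inter>t::real. (\<lambda>g. t *\<^sub>R g) -` G_of \<mu>)"
  proof
    show "(\<Inter>t::real. (\<lambda>g. t *\<^sub>R g) -` G_of \<mu>) \<subseteq> V_of \<mu>"
    proof
      fix g assume g: "g \<in> (\<Inter>t::real. (\<lambda>g. t *\<^sub>R g) -` G_of \<mu>)"
      then have "1 *\<^sub>R g \<in> G_of \<mu>" by blast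
      with g show "g \<in> V_of \<mu>" by (simp add: V_of_def)
    qed
  qed (auto simp: V_of_def)
  moreover have "closed ((\<lambda>g. t *\<^sub>R g) -` G_of \<mu>)" for t :: real
    unfolding G_of_def by (intro closed_vimage) (auto intro: continuous_intros)
  ultimately show ?thesis by auto
qed

text \<open>Almost every \<open>z\<close> lies in \<open>G_of \<mu>\<close>, and by
  \<open>closed_subgroup_gap\<close> those outside \<open>V_of \<mu>\<close> have norm at least
  \<open>e\<close>; hence |z| is at most |z|^2 / e on the domain.\<close>

lemma c_of_integrable: "integrable \<mu> (\<lambda>z. indicator ({z. norm z \<le> 1} - V_of \<mu>) z *\<^sub>R z)"
proof -
  obtain e where e: "e > 0" "\<And>g. g \<in> G_of \<mu> \<Longrightarrow> norm g < e \<Longrightarrow> g \<in> V_of \<mu>"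
    using closed_subgroup_gap[OF _ G_of_group, of \<mu>] unfolding V_of_def by (auto simp: G_of_def)
  have [measurable]: "{z. norm z \<le> 1} - V_of \<mu> \<in> sets borel" using closed_V_of by (auto intro!: borel_closed)
  have "AE z in \<mu>. norm (indicator ({z. norm z \<le> 1} - V_of \<mu>) z *\<^sub>R z) \<le> norm (1 / e * min ((norm z)\<^sup>2) 1)"
    using AE_msupp
  proof eventually_elim
    fix z assume "z \<in> msupp \<mu>"
    then have "z \<in> G_of \<mu>" using msupp_subset_G_of by blast
    show "norm (indicator ({z. norm z \<le> 1} - V_of \<mu>) z *\<^sub>R z) \<le> norm (1 / e * min ((norm z)\<^sup>2) 1)"
    proof (cases "z \<in> {z. norm z \<le> 1} - V_of \<mu>")
      case True
      then have z: "norm z \<le> 1" "e \<le> norm z" using e(2)[OF \<open>z \<in> G_of \<mu>\<close>] by force+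
      then have m: "min ((norm z)\<^sup>2) 1 = (norm z)\<^sup>2" by (simp add: abs_square_le_1)
      have "e * norm z \<le> (norm z)\<^sup>2" using z(2) by (simp add: power2_eq_square mult_right_mono)
      then have "norm z \<le> 1 / e * (norm z)\<^sup>2" using e(1) by (simp add: field_simps)
      then show ?thesis using True e(1) unfolding m by simp
    qed (use e in simp)
  qed
  moreover have "(\<lambda>z. indicator ({z. norm z \<le> 1} - V_of \<mu>) z *\<^sub>R z) \<in> borel_measurable \<mu>"
    by (intro measurable_mu borel_measurable_scaleR borel_measurable_indicator measurable_ident) measurable
  ultimately show ?thesis
    using Bochner_Integration.integrable_bound[OF integrable_mult_right[OF integrable_min, of "1 / e"]] by blast
qed

text \<open>On the support \<open>f (x + z) - f x\<close> vanishes, so only the compensator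
  survives. It vanishes too for \<open>z\<close> in \<open>V_of \<mu>\<close>, along which
  \<open>f\<close> is constant on lines; the rest is integrable and can be separated from the
  gradient.\<close>

lemma nonlocal_op_of_periodic:
  assumes f: "smooth_bdd f" and G: "G_of \<mu> \<subseteq> periods f"
  shows "nonlocal_op \<mu> f x = c_of \<mu> \<bullet> gradient f x"
proof -
  let ?I = "indicator ({z. norm z \<le> 1} - V_of \<mu>) :: real ^ 'n \<Rightarrow> real"
  have "nonlocal_op \<mu> f x = (LINT z|\<mu>. (- (?I z *\<^sub>R z)) \<bullet> gradient f x)"
    unfolding nonlocal_op_jump
  proof (rule integral_cong_AE)
    show "AE z in \<mu>. jump f x z = - (?I z *\<^sub>R z) \<bullet> gradient f x"
      using AE_msupp
    proof eventually_elim
      fix z assume "z \<in> msupp \<mu>"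
      then have "f (x + z) = f x" using G msupp_subset_G_of by (auto simp: periods_def)
      moreover have "z \<bullet> gradient f x = 0" if "z \<in> V_of \<mu>"
        using that G by (intro gradient_orthogonal_periods f) (auto simp: V_of_def)
      ultimately show "jump f x z = - (?I z *\<^sub>R z) \<bullet> gradient f x"
        by (auto simp: jump_def indicator_def)
    qed
    show "jump f x \<in> borel_measurable \<mu>" using jump_integrable[OF f] by blast
    show "(\<lambda>z. - (?I z *\<^sub>R z) \<bullet> gradient f x) \<in> borel_measurable \<mu>"
      by (intro borel_measurable_inner borel_measurable_const borel_measurable_uminus
        borel_measurable_integrable c_of_integrable)
  qed
  also have "\<dots> = (LINT z|\<mu>. - (?I z *\<^sub>R z)) \<bullet> gradient f x"
    by (intro integral_inner_left integrable_minus c_of_integrable)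
  also have "\<dots> = c_of \<mu> \<bullet> gradient f x"
    by (simp add: c_of_def set_lebesgue_integral_def)
  finally show ?thesis .
qed

lemma full_op_of_periodic:
  assumes f: "smooth_bdd f" and G: "G_of \<mu> \<subseteq> periods f"
  shows "full_op \<sigma> b \<mu> f x = sum_op UNIV (\<lambda>j. column j \<sigma>) (b + c_of \<mu>) f x"
  using nonlocal_op_of_periodic[OF assms]
  by (simp add: full_op_def local_op_sum_op f sum_op_def inner_add_left)

lemma G_of_subset_periods:
  assumes f: "smooth_bdd f" and eq: "\<And>x. full_op \<sigma> b \<mu> f x = 0"
  shows "G_of \<mu> \<subseteq> periods f"
  unfolding G_of_def
  by (intro closure_minimal group_closure_subset_periods support_subset_periods[OF assms]
    closed_periods smooth_bdd_continuous f)

end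

section \<open>The Liouville theorem for the local part\<close>

text \<open>
  Reflection coupling: \<open>(x, s) \<mapsto> f (x + s e) - f (x - s e)\<close> solves an equation in which
  \<open>s\<close> is an additional diffusion variable of its own, it vanishes for \<open>s = 0\<close>, and linear
  functions of \<open>s\<close> are barriers on the strip \<open>0 \<le> s \<le> R\<close>.
\<close>

lemma reflection_coupling_bound:
  fixes f :: "real ^ 'n::finite \<Rightarrow> real" and s :: "'j::finite \<Rightarrow> real ^ 'n"
  assumes f: "smooth_bdd f" and C: "\<And>x. \<bar>f x\<bar> \<le> C"
    and eq: "\<And>x. sum_op UNIV s b f x = 0"
    and s0: "0 < s0" "s0 < R"
  shows "f (x0 + s0 *\<^sub>R s j) - f (x0 - s0 *\<^sub>R s j) \<le> 2 * C * s0 / R"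
proof (rule ccontr)
  assume neg: "\<not> f (x0 + s0 *\<^sub>R s j) - f (x0 - s0 *\<^sub>R s j) \<le> 2 * C * s0 / R"
  define e where "e = s j"
  define p where "p = f (x0 + s0 *\<^sub>R e) - f (x0 - s0 *\<^sub>R e) - 2 * C * s0 / R"
  have p: "p > 0" using neg by (simp add: p_def e_def)
  have R: "R > 0" using s0 by simp
  have C0: "C \<ge> 0" using C[of 0] by linarith
  \<comment> \<open>As \<open>s0 * (R - s0) \<le> R * R\<close>, the quadratic term costs at most
    half of the assumed excess \<open>p\<close>.\<close>
  define \<epsilon> where "\<epsilon> = p / (2 * R\<^sup>2)"
  have \<epsilon>: "\<epsilon> > 0" using p R by (simp add: \<epsilon>_def)
  \<comment> \<open>The linear barrier reaches \<open>2 * C\<close> at \<open>t = R\<close>, enough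
    to dominate the difference there; at \<open>t = 0\<close> both vanish. The quadratic term is 0
    at both ends and adds \<open>2 * \<epsilon>\<close> to the second derivative in
    \<open>t\<close>, which yields strictness.\<close>
  define P where "P x t = f (x + t *\<^sub>R e) - f (x - t *\<^sub>R e) - 2 * C * t / R - \<epsilon> * (t * (R - t))" for x t
  have Pbound: "P x t \<le> 2 * C" if "t \<in> {0..R}" for x t
  proof -
    have "0 \<le> 2 * C * t / R" "0 \<le> \<epsilon> * (t * (R - t))" using that C0 R \<epsilon> by auto
    then show ?thesis using C[of "x + t *\<^sub>R e"] C[of "x - t *\<^sub>R e"] by (auto simp: P_def)
  qed
  have P0: "P x0 s0 \<ge> p / 2"
  proof -
    have "s0 * (R - s0) \<le> R * R" using s0 by (intro mult_mono) auto
    then have "\<epsilon> * (s0 * (R - s0)) \<le> \<epsilon> * (R * R)" using \<epsilon> by (intro mult_left_mono) auto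
    also have "\<dots> = p / 2" using R by (simp add: \<epsilon>_def power2_eq_square)
    finally show ?thesis by (simp add: P_def p_def)
  qed
  define S where "S = (UNIV :: (real ^ 'n) set) \<times> {0..R}"
  define m where "m = (SUP z\<in>S. P (fst z) (snd z))"
  have bdd: "bdd_above ((\<lambda>z. P (fst z) (snd z)) ` S)"
    by (rule bdd_aboveI2[of _ _ "2 * C"]) (auto simp: S_def intro!: Pbound)
  have Pm: "P x t \<le> m" if "t \<in> {0..R}" for x t
    unfolding m_def using cSUP_upper[OF _ bdd, of "(x, t)"] that by (simp add: S_def)
  have m: "m \<ge> p / 2" using P0 Pm[of s0 x0] s0 by auto
  obtain \<eta> :: "real ^ 'n \<Rightarrow> real" where \<eta>: "test_function \<eta>" "\<eta> 0 = 1" "\<And>x. 0 \<le> \<eta> x" "\<And>x. \<eta> x \<le> 1"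
    "\<And>x. norm x \<ge> 1 \<Longrightarrow> \<eta> x = 0" using exists_bump[of 1] by auto
  note \<eta>s = test_function_smooth_bdd[OF \<eta>(1)]
  \<comment> \<open>Direction \<open>e\<close> is left out; the second derivative in
    \<open>t\<close> stands in for it.\<close>
  define J where "J = UNIV - {j}"
  obtain D where D: "D \<ge> 0" "\<And>x. \<bar>sum_op J s b \<eta> x\<bar> \<le> D" using sum_op_bound[OF \<eta>s] by blast
  \<comment> \<open>The bound \<open>p / 4\<close> prevents the bump from creating a maximum on the
    boundary of the strip; the other one keeps its error \<open>\<delta> * D\<close> below
    \<epsilon>.\<close>
  define \<delta> where "\<delta> = min (p / 4) (\<epsilon> / (2 * (D + 1)))"
  have "\<epsilon> / (2 * (D + 1)) > 0" using \<epsilon> D(1) by simp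
  then have \<delta>: "\<delta> > 0" "\<delta> \<le> p / 4" "\<delta> \<le> \<epsilon> / (2 * (D + 1))" using p unfolding \<delta>_def by linarith+
  have \<delta>D: "\<delta> * D < \<epsilon>"
  proof -
    have "\<delta> * D \<le> \<epsilon> / (2 * (D + 1)) * D" using \<delta>(3) D(1) by (rule mult_right_mono)
    also have "\<dots> = \<epsilon> * (D / (2 * (D + 1)))" by simp
    also have "\<dots> < \<epsilon> * 1" using \<epsilon> D(1) by (intro mult_strict_left_mono) (auto simp: field_simps)
    finally show ?thesis by simp
  qed
  have "S \<noteq> {}" using R by (auto simp: S_def)
  then have "\<exists>z\<in>S. m - \<delta> < P (fst z) (snd z)"
    using less_cSUP_iff[OF _ bdd, of "m - \<delta>"] \<delta>(1) unfolding m_def by simp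
  then obtain x1 s1 where x1: "s1 \<in> {0..R}" "m - \<delta> < P x1 s1" by (auto simp: S_def)
  \<comment> \<open>Only \<open>x\<close> ranges over a noncompact set, so the bump depends on
    \<open>x\<close> alone.\<close>
  define Q where "Q x t = P x t + 2 * \<delta> * \<eta> (x + (- x1))" for x t
  have Q1: "Q x1 s1 > m + \<delta>" using x1(2) \<eta>(2) by (simp add: Q_def)
  have cont: "continuous_on A (\<lambda>z. Q (fst z) (snd z))" for A
    unfolding Q_def P_def by (intro continuous_intros continuous_on_compose2[OF smooth_bdd_continuous[OF f, of UNIV]]
      continuous_on_compose2[OF smooth_bdd_continuous[OF \<eta>s, of UNIV]]) (use R in auto)
  have "\<exists>z\<in>cball x1 1 \<times> {0..R}. \<forall>z'\<in>cball x1 1 \<times> {0..R}. Q (fst z') (snd z') \<le> Q (fst z) (snd z)"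
    using R by (intro continuous_attains_sup cont compact_Times) auto
  then obtain z where z: "z \<in> cball x1 1 \<times> {0..R}"
    "\<And>z'. z' \<in> cball x1 1 \<times> {0..R} \<Longrightarrow> Q (fst z') (snd z') \<le> Q (fst z) (snd z)" by blast
  define y where "y = fst z"
  define t where "t = snd z"
  have yt: "t \<in> {0..R}" "\<And>x' t'. x' \<in> cball x1 1 \<Longrightarrow> t' \<in> {0..R} \<Longrightarrow> Q x' t' \<le> Q y t"
    using z(1) z(2)[OF SigmaI] by (auto simp: y_def t_def)
  have Qy: "Q y t > m + \<delta>" using yt(2)[of x1 s1] x1(1) Q1 by auto
  have max: "Q x' t' \<le> Q y t" if t': "t' \<in> {0..R}" for x' t'
  proof (cases "x' \<in> cball x1 1")
    case False
    then have "\<eta> (x' + (- x1)) = 0" by (intro \<eta>(5)) (simp add: dist_norm norm_minus_commute)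
    then show ?thesis using Pm[OF t', of x'] Qy \<delta>(1) by (simp add: Q_def)
  qed (rule yt(2)[OF _ t'])
  have t: "0 < t" "t < R"
  proof -
    have "2 * \<delta> * \<eta> (y + (- x1)) \<le> 2 * \<delta>" using \<eta>(4) \<delta>(1) by simp
    moreover have "P y 0 = 0" by (simp add: P_def)
    moreover have "P y R \<le> 0" using C[of "y + R *\<^sub>R e"] C[of "y - R *\<^sub>R e"] R by (simp add: P_def abs_le_iff)
    ultimately have "Q y 0 \<le> 2 * \<delta>" "Q y R \<le> 2 * \<delta>" by (simp_all add: Q_def)
    moreover have "2 * \<delta> < m + \<delta>" using m \<delta>(2) p by linarith
    ultimately have "t \<noteq> 0" "t \<noteq> R" using Qy by auto
    then show "0 < t" "t < R" using yt(1) by auto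
  qed
  \<comment> \<open>The slice of \<open>Q\<close> at height \<open>t\<close>, up to a constant, so
    that it is maximal at \<open>y\<close>.\<close>
  define h where "h x = f (x + t *\<^sub>R e) + (- 1) * f (x + (- (t *\<^sub>R e))) + 2 * \<delta> * \<eta> (x + (- x1))" for x
  have hs: "smooth_bdd h"
    unfolding h_def[abs_def] by (intro smooth_bdd_add smooth_bdd_cmult smooth_bdd_shift f \<eta>s)
  have hmax: "h x \<le> h y" for x using max[OF yt(1), of x] by (simp add: Q_def P_def h_def)
  have "sum_op J s b h y \<le> 0"
    using smooth_bdd_max(2)[OF hs hmax] smooth_bdd_max(1)[OF hs hmax] by (simp add: sum_op_def sum_nonpos)
  moreover have "sum_op J s b h y = sum_op J s b f (y + t *\<^sub>R e) + (- 1) * sum_op J s b f (y + (- (t *\<^sub>R e)))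
      + 2 * \<delta> * sum_op J s b \<eta> (y + (- x1))"
    unfolding h_def[abs_def]
    by (simp only: sum_op_add sum_op_cmult sum_op_shift f \<eta>s smooth_bdd_add smooth_bdd_cmult smooth_bdd_shift)
  moreover have "sum_op J s b f x = - ddir e (ddir e f) x" for x
  proof -
    have "(\<Sum>i\<in>UNIV. ddir (s i) (ddir (s i) f) x) = ddir e (ddir e f) x + (\<Sum>i\<in>J. ddir (s i) (ddir (s i) f) x)"
      unfolding J_def e_def by (rule sum.remove) auto
    then show ?thesis using eq[of x] by (simp add: sum_op_def)
  qed
  \<comment> \<open>The equation at both reflected points converts maximality in \<open>x\<close>
    into a lower bound for the difference of second derivatives along \<open>e\<close>; maximality
    in \<open>t\<close> will bound it above by \<open>- 2 * \<epsilon>\<close>.\<close>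
  ultimately have 1: "2 * (\<delta> * sum_op J s b \<eta> (y + (- x1)))
    \<le> ddir e (ddir e f) (y + t *\<^sub>R e) - ddir e (ddir e f) (y + (- (t *\<^sub>R e)))" by simp
  have 2: "- (\<delta> * D) \<le> \<delta> * sum_op J s b \<eta> (y + (- x1))"
    using D(2)[of "y + (- x1)"] \<delta>(1) mult_left_mono[of "- D" "sum_op J s b \<eta> (y + (- x1))" \<delta>] by simp
  have minus: "((\<lambda>\<tau>. g (y - \<tau> *\<^sub>R e)) has_real_derivative - ddir e g (y - \<tau> *\<^sub>R e)) (at \<tau>)"
    if "smooth_bdd g" for g \<tau>
  proof -
    have "((\<lambda>\<tau>. g (y + (- \<tau>) *\<^sub>R e)) has_real_derivative ddir e g (y + (- \<tau>) *\<^sub>R e) * (- 1)) (at \<tau>)"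
      by (rule DERIV_chain2[OF ddir_line[OF that]]) (auto intro!: derivative_eq_intros)
    then show ?thesis by simp
  qed
  define q' where "q' \<tau> = ddir e f (y + \<tau> *\<^sub>R e) + ddir e f (y - \<tau> *\<^sub>R e) - 2 * C / R - \<epsilon> * (R - 2 * \<tau>)" for \<tau>
  have "ddir e (ddir e f) (y + t *\<^sub>R e) - ddir e (ddir e f) (y - t *\<^sub>R e) + 2 * \<epsilon> \<le> 0"
  proof (rule conjunct2[OF max_second_derivative])
    show "((\<lambda>\<tau>. P y \<tau>) has_real_derivative q' \<tau>) (at \<tau>)" for \<tau>
    proof -
      have "((\<lambda>\<tau>. f (y + \<tau> *\<^sub>R e) - f (y - \<tau> *\<^sub>R e) - 2 * C * \<tau> / R - \<epsilon> * (\<tau> * (R - \<tau>))) has_real_derivative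
        (ddir e f (y + \<tau> *\<^sub>R e) - (- ddir e f (y - \<tau> *\<^sub>R e)) - 2 * C * 1 / R - \<epsilon> * (1 * (R - \<tau>) + (0 - 1) * \<tau>))) (at \<tau>)"
        by (intro DERIV_diff ddir_line[OF f] minus[OF f] DERIV_cdivide DERIV_cmult DERIV_mult DERIV_ident DERIV_const)
      then show ?thesis unfolding P_def q'_def by (rule DERIV_cong) (simp add: algebra_simps)
    qed
    show "(q' has_real_derivative ddir e (ddir e f) (y + t *\<^sub>R e) - ddir e (ddir e f) (y - t *\<^sub>R e) + 2 * \<epsilon>) (at t)"
    proof -
      have "((\<lambda>\<tau>. ddir e f (y + \<tau> *\<^sub>R e) + ddir e f (y - \<tau> *\<^sub>R e) - 2 * C / R - \<epsilon> * (R - 2 * \<tau>)) has_real_derivative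
        (ddir e (ddir e f) (y + t *\<^sub>R e) + (- ddir e (ddir e f) (y - t *\<^sub>R e)) - 0 - \<epsilon> * (0 - 2 * 1))) (at t)"
        by (intro DERIV_diff DERIV_add ddir_line minus ddir_smooth_bdd f DERIV_cmult DERIV_ident DERIV_const)
      then show ?thesis unfolding q'_def[abs_def] by (rule DERIV_cong) simp
    qed
    show "0 < min t (R - t)" using t by simp
    show "P y \<tau> \<le> P y t" if "\<bar>\<tau> - t\<bar> < min t (R - t)" for \<tau>
    proof -
      have "\<tau> \<in> {0..R}" using that by auto
      from max[OF this, of y] show ?thesis by (simp add: Q_def)
    qed
  qed
  with 1 2 \<delta>D show False by simp
qed

text \<open>The coupling estimate tends to 0 as the width \<open>R\<close> grows. Used for
  \<open>f\<close> and its negative it gives equality at reflected points, and centring at the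
  midpoint \<open>z\<close> turns reflection into translation.\<close>

lemma local_liouville_columns:
  fixes s :: "'j::finite \<Rightarrow> real ^ 'n::finite"
  assumes f: "smooth_bdd f" and eq: "\<And>x. sum_op UNIV s b f x = 0"
  shows "t *\<^sub>R s j \<in> periods f"
proof -
  have le: "g (x + r *\<^sub>R s j) \<le> g (x - r *\<^sub>R s j)" if g: "smooth_bdd g" "\<And>x. sum_op UNIV s b g x = 0" and r: "r > 0" for g x r
  proof -
    obtain C where C: "\<And>x. \<bar>g x\<bar> \<le> C" using smooth_bdd_bound[OF g(1)] by blast
    have "(\<lambda>n. 2 * C * r / real n) \<longlonglongrightarrow> 0" by (rule lim_const_over_n)
    moreover have "\<forall>\<^sub>F n in sequentially. g (x + r *\<^sub>R s j) - g (x - r *\<^sub>R s j) \<le> 2 * C * r / real n"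
      using eventually_gt_at_top[of "nat \<lceil>r\<rceil>"]
      by eventually_elim (rule reflection_coupling_bound[OF g(1) C g(2) r], linarith)
    ultimately have "g (x + r *\<^sub>R s j) - g (x - r *\<^sub>R s j) \<le> 0"
      by (intro tendsto_lowerbound[of _ _ sequentially]) auto
    then show ?thesis by simp
  qed
  have eq': "sum_op UNIV s b (\<lambda>x. (- 1) * f x) x = 0" for x by (simp only: sum_op_cmult[OF f] eq mult_zero_right)
  have pos: "f (x + r *\<^sub>R s j) = f (x - r *\<^sub>R s j)" if "r > 0" for x r
    using le[OF f eq that, of x] le[OF smooth_bdd_cmult[OF f] eq' that, of x] by simp
  have "f (x + t *\<^sub>R s j) = f x" for x
  proof -
    define z where "z = x + (t / 2) *\<^sub>R s j"
    have z: "z + (t / 2) *\<^sub>R s j = x + t *\<^sub>R s j" "z - (t / 2) *\<^sub>R s j = x"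
      by (simp_all add: z_def scaleR_add_left[symmetric] add.assoc)
    consider "t > 0" | "t = 0" | "t < 0" by linarith
    then show ?thesis
    proof cases
      case 1
      then show ?thesis using pos[of "t / 2" z] z by simp
    next
      case 3
      then have "f (z + (- t / 2) *\<^sub>R s j) = f (z - (- t / 2) *\<^sub>R s j)" by (intro pos) simp
      then show ?thesis using z by simp
    qed simp
  qed
  then show ?thesis by (simp add: periods_def)
qed

lemma ddir_periodic:
  assumes "smooth_bdd f" "\<And>t::real. t *\<^sub>R v \<in> periods f"
  shows "ddir v f = (\<lambda>x. 0)"
  using gradient_orthogonal_periods[OF assms] by (simp add: ddir_def fun_eq_iff)

lemma ddir_zero: "ddir v (\<lambda>x. 0) x = 0"
  by (simp add: ddir_def gradient_def partial_def inner_vec_def)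

text \<open>Constancy along the columns removes all second derivatives; the equation then says that
  the derivative along \<open>b\<close> is 0.\<close>

lemma local_liouville_drift:
  fixes s :: "'j::finite \<Rightarrow> real ^ 'n::finite"
  assumes f: "smooth_bdd f" and eq: "\<And>x. sum_op UNIV s b f x = 0"
  shows "t *\<^sub>R b \<in> periods f"
proof -
  have "ddir b f x = 0" for x
    using eq[of x] ddir_periodic[OF f local_liouville_columns[OF f eq]]
    by (simp add: sum_op_def ddir_zero) (simp add: ddir_def)
  then have "\<forall>t. ((\<lambda>t. f (x + t *\<^sub>R b)) has_real_derivative 0) (at t)" for x
    using ddir_line[OF f, of x b] by simp
  from DERIV_isconst_all[OF this, of _ t 0] show ?thesis by (simp add: periods_def)
qed

text \<open>Periods only form a group; the span is reached through the subspace of vectors all of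
  whose real multiples are periods.\<close>

lemma local_liouville:
  fixes \<sigma> :: "real ^ 'p::finite ^ 'n::finite"
  assumes f: "smooth_bdd f" and eq: "\<And>x. sum_op UNIV (\<lambda>j. column j \<sigma>) b f x = 0"
  shows "W_of \<sigma> b \<subseteq> periods f"
proof -
  have "span (columns \<sigma> \<union> {b}) \<subseteq> {w. \<forall>t::real. t *\<^sub>R w \<in> periods f}"
  proof (rule span_minimal)
    show "subspace {w. \<forall>t::real. t *\<^sub>R w \<in> periods f}"
      unfolding subspace_def by (auto simp: zero_periods scaleR_add_right add_periods)
    show "columns \<sigma> \<union> {b} \<subseteq> {w. \<forall>t::real. t *\<^sub>R w \<in> periods f}"
      using local_liouville_columns[OF f eq] local_liouville_drift[OF f eq] by (auto simp: columns_def)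
  qed
  then have "1 *\<^sub>R w \<in> periods f" if "w \<in> W_of \<sigma> b" for w using that unfolding W_of_def by blast
  then show ?thesis by auto
qed

text \<open>Periodicity under \<open>G_of \<mu>\<close> has to come first: it is what makes the
  operator local with drift \<open>b + c_of \<mu>\<close>.\<close>

lemma (in levy) liouville_periods:
  assumes f: "smooth_bdd f" and eq: "\<And>x. full_op \<sigma> b \<mu> f x = 0"
  shows "G_of \<mu> \<subseteq> periods f" and "W_of \<sigma> (b + c_of \<mu>) \<subseteq> periods f"
proof -
  show G: "G_of \<mu> \<subseteq> periods f" by (rule G_of_subset_periods[OF f eq])
  show "W_of \<sigma> (b + c_of \<mu>) \<subseteq> periods f"
    by (rule local_liouville[OF f]) (use full_op_of_periodic[OF f G] eq in metis)
qed

lemma (in levy) full_op_zero_of_periods: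
  assumes f: "smooth_bdd f" and G: "G_of \<mu> \<subseteq> periods f" and W: "W_of \<sigma> (b + c_of \<mu>) \<subseteq> periods f"
  shows "full_op \<sigma> b \<mu> f x = 0"
proof -
  have W': "t *\<^sub>R w \<in> periods f" if "w \<in> columns \<sigma> \<union> {b + c_of \<mu>}" for t :: real and w
    using W span_scale[OF span_base[OF that]] by (auto simp: W_of_def)
  have "ddir (column j \<sigma>) f = (\<lambda>x. 0)" for j
    by (intro ddir_periodic f W') (auto simp: columns_def)
  moreover have "(b + c_of \<mu>) \<bullet> gradient f x = 0"
    by (intro gradient_orthogonal_periods f W') simp
  ultimately show ?thesis by (simp add: full_op_of_periodic[OF f G] sum_op_def ddir_zero)
qed

section \<open>Regularisation by test functions\<close>

lemma test_function_iff: "test_function \<psi> \<longleftrightarrow> smooth_bdd \<psi> \<and> bounded {x. \<psi> x \<noteq> 0}"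
  using test_function_smooth_bdd[of \<psi>] by (auto simp: test_function_def smooth_bdd_def compact_closure)

lemma test_function_cmult: "test_function \<psi> \<Longrightarrow> test_function (\<lambda>x. c * \<psi> x)"
  unfolding test_function_iff by (auto intro: smooth_bdd_cmult bounded_subset)

lemma test_function_ddir: "test_function \<psi> \<Longrightarrow> test_function (ddir v \<psi>)"
proof -
  assume \<psi>: "test_function \<psi>"
  have "bounded (\<Union>i\<in>UNIV. {x. partial i \<psi> x \<noteq> 0})"
    using test_function_partial[OF \<psi>] by (intro bounded_UN) (auto simp: test_function_iff)
  moreover have "{x. ddir v \<psi> x \<noteq> 0} \<subseteq> (\<Union>i\<in>UNIV. {x. partial i \<psi> x \<noteq> 0})"
    unfolding ddir_sum by (auto elim!: sum.not_neutral_contains_not_neutral)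
  ultimately have "bounded {x. ddir v \<psi> x \<noteq> 0}" by (rule bounded_subset)
  then show ?thesis using \<psi> by (simp add: test_function_iff ddir_smooth_bdd)
qed

lemma test_function_shift: "test_function \<psi> \<Longrightarrow> test_function (\<lambda>x. \<psi> (x + a))"
proof -
  assume \<psi>: "test_function \<psi>"
  then obtain R where R: "\<And>x. norm x > R \<Longrightarrow> \<psi> x = 0" using test_function_support by blast
  have "{x. \<psi> (x + a) \<noteq> 0} \<subseteq> cball (- a) R"
    using R by (force simp: dist_norm norm_minus_commute add.commute)
  then have "bounded {x. \<psi> (x + a) \<noteq> 0}" by (rule bounded_subset[OF bounded_cball])
  then show ?thesis using \<psi> by (simp add: test_function_iff smooth_bdd_shift)
qed

lemma gradient_outside_support:
  assumes "test_function \<psi>" "\<And>x. norm x > R \<Longrightarrow> \<psi> x = 0" "norm x > R"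
  shows "gradient \<psi> x = 0"
proof -
  have o: "open {x. norm x > R}" by (intro open_Collect_less continuous_intros)
  have "((\<lambda>x. 0) has_derivative (\<lambda>h. 0)) (at x)" by simp
  then have "(\<psi> has_derivative (\<lambda>h. 0)) (at x)"
    by (rule has_derivative_transform_within_open[OF _ o]) (use assms in auto)
  from frechet_derivative_at[OF this] show ?thesis
    by (simp add: gradient_def partial_def fun_eq_iff vec_eq_iff)
qed

lemma integral_lborel_shift:
  fixes f :: "'a::euclidean_space \<Rightarrow> real"
  assumes [measurable]: "f \<in> borel_measurable borel"
  shows "(LINT y|lborel. f (y + c)) = (LINT y|lborel. f y)"
proof -
  have "(LINT y|lborel. f y) = (LINT y|distr lborel borel ((+) c). f y)" by (simp add: lborel_distr_plus)
  also have "\<dots> = (LINT y|lborel. f (c + y))" by (rule integral_distr) auto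
  finally show ?thesis by (simp add: add.commute)
qed

lemma integrable_bounded_support:
  fixes f :: "'a::euclidean_space \<Rightarrow> real"
  assumes f: "f \<in> borel_measurable borel" and A: "\<And>y. \<bar>f y\<bar> \<le> A" and R: "\<And>y. y \<notin> cball c R \<Longrightarrow> f y = 0"
  shows "integrable lborel f" and "\<bar>LINT y|lborel. f y\<bar> \<le> A * measure lborel (cball c R)"
proof -
  have i: "integrable lborel (\<lambda>y. A * indicator (cball c R) y)"
    by (intro integrable_mult_right integrable_real_indicator) (auto simp: emeasure_lborel_cball_finite[unfolded infinity_ennreal_def])
  have le: "norm (f y) \<le> A * indicator (cball c R) y" for y
    using A[of y] R[of y] by (auto simp: indicator_def)
  have "norm (f y) \<le> norm (A * indicator (cball c R) y :: real)" for y
    using le[of y] abs_ge_self order_trans unfolding real_norm_def by blast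
  then show fi: "integrable lborel f"
    by (intro Bochner_Integration.integrable_bound[OF i]) (use f in auto)
  have "norm (LINT y|lborel. f y) \<le> (LINT y|lborel. A * indicator (cball c R) y)"
    by (rule Bochner_Integration.integral_norm_bound_integral[OF fi i le])
  then show "\<bar>LINT y|lborel. f y\<bar> \<le> A * measure lborel (cball c R)" by simp
qed

text \<open>A correlation, not a convolution: the value at \<open>x\<close> pairs \<open>u\<close>
  with the translate of \<psi> by \<open>x\<close>, without reflection. Each derivative passed on to
  \<psi> costs a sign.\<close>

definition corr :: "(real ^ 'n::finite \<Rightarrow> real) \<Rightarrow> (real ^ 'n \<Rightarrow> real) \<Rightarrow> real ^ 'n \<Rightarrow> real" where
  "corr u \<psi> x = (LINT y|lborel. u y * \<psi> (y - x))"

text \<open>Borel measurable and bounded everywhere, so that product measurability and Fubini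
  involve no exceptional sets of \<open>u\<close>.\<close>

locale bounded_borel =
  fixes u :: "real ^ 'n::finite \<Rightarrow> real" and B :: real
  assumes u_borel [measurable]: "u \<in> borel_measurable borel"
    and u_bound: "\<And>y. \<bar>u y\<bar> \<le> B"
begin

lemma B_nonneg: "B \<ge> 0"
  using u_bound[of 0] by linarith

lemma corr_integrable:
  assumes \<psi>: "test_function \<psi>"
  shows "integrable lborel (\<lambda>y. u y * \<psi> (y - x))"
proof -
  obtain R where R: "\<And>x. norm x > R \<Longrightarrow> \<psi> x = 0" using test_function_support[OF \<psi>] by blast
  obtain A where A: "A \<ge> 0" "\<And>x. \<bar>\<psi> x\<bar> \<le> A" using smooth_bdd_bound[OF test_function_smooth_bdd[OF \<psi>]] by blast
  note [measurable] = smooth_bdd_borel[OF test_function_smooth_bdd[OF \<psi>]]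
  show ?thesis
  proof (rule integrable_bounded_support)
    show "(\<lambda>y. u y * \<psi> (y - x)) \<in> borel_measurable borel" by measurable
    show "\<bar>u y * \<psi> (y - x)\<bar> \<le> B * A" for y
      unfolding abs_mult using u_bound A B_nonneg by (intro mult_mono) auto
    show "y \<notin> cball x R \<Longrightarrow> u y * \<psi> (y - x) = 0" for y
      using R[of "y - x"] by (simp add: dist_norm norm_minus_commute)
  qed
qed

lemma corr_cmult: "corr u (\<lambda>y. c * \<psi> y) x = c * corr u \<psi> x"
proof -
  have "(\<lambda>y. u y * (c * \<psi> (y - x))) = (\<lambda>y. c * (u y * \<psi> (y - x)))" by (simp add: mult_ac)
  then show ?thesis by (simp add: corr_def)
qed

lemma corr_ddir_sum:
  assumes \<psi>: "test_function \<psi>"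
  shows "corr u (ddir h \<psi>) x = (\<Sum>i\<in>UNIV. h $ i * corr u (partial i \<psi>) x)"
proof -
  have "corr u (ddir h \<psi>) x = (LINT y|lborel. (\<Sum>i\<in>UNIV. u y * (h $ i * partial i \<psi> (y - x))))"
    unfolding corr_def ddir_sum sum_distrib_left ..
  also have "\<dots> = (\<Sum>i\<in>UNIV. LINT y|lborel. u y * (h $ i * partial i \<psi> (y - x)))"
    by (intro Bochner_Integration.integral_sum corr_integrable test_function_cmult test_function_partial \<psi>)
  also have "\<dots> = (\<Sum>i\<in>UNIV. h $ i * corr u (partial i \<psi>) x)"
    using corr_cmult by (intro sum.cong refl) (simp add: corr_def)
  finally show ?thesis .
qed

text \<open>The Taylor remainder of \<psi> is uniformly quadratic, and for \<open>norm h < 1\<close>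
  it is supported in the ball of radius \<open>R + 1\<close> around \<open>x\<close>; integration
  against \<open>u\<close> keeps it quadratic.\<close>

lemma corr_has_derivative:
  assumes \<psi>: "test_function \<psi>"
  shows "(corr u \<psi> has_derivative (\<lambda>h. - corr u (ddir h \<psi>) x)) (at x)"
proof -
  note \<psi>s = test_function_smooth_bdd[OF \<psi>]
  obtain R where R: "\<And>x. norm x > R \<Longrightarrow> \<psi> x = 0" using test_function_support[OF \<psi>] by blast
  obtain K where K: "K \<ge> 0" "\<And>x z. \<bar>\<psi> (x + z) - \<psi> x - z \<bullet> gradient \<psi> x\<bar> \<le> K * (norm z)\<^sup>2"
    using taylor2[OF \<psi>s] by blast
  note [measurable] = smooth_bdd_borel[OF \<psi>s]
  show ?thesis
  proof (rule has_derivative_quadratic_remainder)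
    have "bounded_linear (\<lambda>h. \<Sum>i\<in>UNIV. h $ i * (- corr u (partial i \<psi>) x))"
      by (intro bounded_linear_sum bounded_linear_compose[OF bounded_linear_mult_left bounded_linear_vec_nth])
    then show "bounded_linear (\<lambda>h. - corr u (ddir h \<psi>) x)"
      unfolding corr_ddir_sum[OF \<psi>] by (simp add: sum_negf)
    fix h :: "real ^ 'n" assume h: "norm h < 1"
    note [measurable] = smooth_bdd_borel[OF ddir_smooth_bdd[OF \<psi>s, of h]]
    have "corr u \<psi> (x + h) - corr u \<psi> x - (- corr u (ddir h \<psi>) x) =
      (LINT y|lborel. u y * \<psi> (y - (x + h)) - u y * \<psi> (y - x) + u y * ddir h \<psi> (y - x))"
      unfolding corr_def by (simp add: corr_integrable \<psi> test_function_ddir)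
    also have "\<bar>\<dots>\<bar> \<le> (B * (K * (norm h)\<^sup>2)) * measure lborel (cball x (R + 1))"
    proof (rule integrable_bounded_support(2))
      show "(\<lambda>y. u y * \<psi> (y - (x + h)) - u y * \<psi> (y - x) + u y * ddir h \<psi> (y - x)) \<in> borel_measurable borel"
        by measurable
      show "\<bar>u y * \<psi> (y - (x + h)) - u y * \<psi> (y - x) + u y * ddir h \<psi> (y - x)\<bar> \<le> B * (K * (norm h)\<^sup>2)" for y
      proof -
        have "u y * \<psi> (y - (x + h)) - u y * \<psi> (y - x) + u y * ddir h \<psi> (y - x)
          = u y * (\<psi> ((y - x) + (- h)) - \<psi> (y - x) - (- h) \<bullet> gradient \<psi> (y - x))"
          by (simp add: ddir_def algebra_simps)
        then show ?thesis unfolding abs_mult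
          using mult_mono[OF u_bound[of y] K(2)[of "y - x" "- h"] B_nonneg] by (simp add: abs_mult)
      qed
      fix y assume "y \<notin> cball x (R + 1)"
      then have y: "norm (y - x) > R + 1" by (simp add: dist_norm norm_minus_commute)
      moreover have "norm (y - x) \<le> norm (y - (x + h)) + norm h"
        using norm_triangle_ineq[of "y - (x + h)" h] by (simp add: algebra_simps)
      ultimately have "\<psi> (y - (x + h)) = 0" using h by (intro R) linarith
      moreover have "\<psi> (y - x) = 0" "gradient \<psi> (y - x) = 0"
        using y gradient_outside_support[OF \<psi> R] by (auto intro!: R)
      ultimately show "u y * \<psi> (y - (x + h)) - u y * \<psi> (y - x) + u y * ddir h \<psi> (y - x) = 0"
        by (simp add: ddir_def)
    qed
    finally show "norm (corr u \<psi> (x + h) - corr u \<psi> x - (- corr u (ddir h \<psi>) x))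
      \<le> (B * K * measure lborel (cball x (R + 1))) * (norm h)\<^sup>2" by (simp add: mult_ac)
  qed
qed

text \<open>The sign stays inside, so that the derivative is again the regularisation by a test
  function and the family in \<open>corr_smooth_bdd\<close> is closed.\<close>

lemma partial_corr:
  assumes \<psi>: "test_function \<psi>"
  shows "partial i (corr u \<psi>) = corr u (\<lambda>y. (- 1) * partial i \<psi> y)"
proof
  fix x
  have "ddir (axis i 1) \<psi> = partial i \<psi>" by (simp add: ddir_def gradient_def inner_axis' fun_eq_iff)
  then have "partial i (corr u \<psi>) x = - corr u (partial i \<psi>) x"
    using fun_cong[OF frechet_derivative_at[OF corr_has_derivative[OF \<psi>, of x]], of "axis i 1"]
    by (simp add: partial_def)
  then show "partial i (corr u \<psi>) x = corr u (\<lambda>y. (- 1) * partial i \<psi> y) x"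
    unfolding corr_cmult by simp
qed

lemma corr_bound:
  assumes \<psi>: "test_function \<psi>"
  shows "\<exists>C. \<forall>x. \<bar>corr u \<psi> x\<bar> \<le> C"
proof -
  obtain R where R: "\<And>x. norm x > R \<Longrightarrow> \<psi> x = 0" "R > 0" using test_function_support[OF \<psi>] by blast
  obtain A where A: "A \<ge> 0" "\<And>x. \<bar>\<psi> x\<bar> \<le> A" using smooth_bdd_bound[OF test_function_smooth_bdd[OF \<psi>]] by blast
  note [measurable] = smooth_bdd_borel[OF test_function_smooth_bdd[OF \<psi>]]
  have "\<bar>corr u \<psi> x\<bar> \<le> B * A * measure lborel (cball x R)" for x
    unfolding corr_def
  proof (rule integrable_bounded_support(2))
    show "(\<lambda>y. u y * \<psi> (y - x)) \<in> borel_measurable borel" by measurable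
    show "\<bar>u y * \<psi> (y - x)\<bar> \<le> B * A" for y
      unfolding abs_mult using u_bound A B_nonneg by (intro mult_mono) auto
    show "y \<notin> cball x R \<Longrightarrow> u y * \<psi> (y - x) = 0" for y
      using R(1)[of "y - x"] by (simp add: dist_norm norm_minus_commute)
  qed
  moreover have "measure lborel (cball x R) = measure lborel (cball (0 :: real ^ 'n) R)" for x :: "real ^ 'n"
    using R(2) by (simp add: content_cball)
  ultimately show ?thesis by (intro exI[of _ "B * A * measure lborel (cball (0 :: real ^ 'n) R)"]) metis
qed

lemma corr_smooth_bdd:
  assumes \<psi>: "test_function \<psi>"
  shows "smooth_bdd (corr u \<psi>)"
proof (rule smooth_bdd_coinduct[where F="{corr u \<psi> | \<psi>. test_function \<psi>}"])
  show "corr u \<psi> \<in> {corr u \<psi> | \<psi>. test_function \<psi>}" using \<psi> by blast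
next
  fix g x assume "g \<in> {corr u \<psi> | \<psi>. test_function \<psi>}"
  then show "g differentiable at x" unfolding differentiable_def using corr_has_derivative by blast
next
  fix g i assume "g \<in> {corr u \<psi> | \<psi>. test_function \<psi>}"
  then show "partial i g \<in> {corr u \<psi> | \<psi>. test_function \<psi>}"
    using partial_corr test_function_cmult test_function_partial by blast
next
  fix g assume "g \<in> {corr u \<psi> | \<psi>. test_function \<psi>}"
  then show "\<exists>C. \<forall>x. \<bar>g x\<bar> \<le> C" using corr_bound by blast
qed

lemma ddir_corr:
  assumes \<psi>: "test_function \<psi>"
  shows "ddir v (corr u \<psi>) = corr u (\<lambda>y. (- 1) * ddir v \<psi> y)"
proof
  fix x
  have "ddir v (corr u \<psi>) x = (\<Sum>i\<in>UNIV. v $ i * (- corr u (partial i \<psi>) x))"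
    unfolding ddir_sum partial_corr[OF \<psi>] corr_cmult by simp
  also have "\<dots> = - corr u (ddir v \<psi>) x" by (simp add: corr_ddir_sum[OF \<psi>] sum_negf)
  finally show "ddir v (corr u \<psi>) x = corr u (\<lambda>y. (- 1) * ddir v \<psi> y) x" unfolding corr_cmult by simp
qed

lemma ddir_ddir_corr:
  assumes \<psi>: "test_function \<psi>"
  shows "ddir v (ddir v (corr u \<psi>)) x = corr u (ddir v (ddir v \<psi>)) x"
  unfolding ddir_corr[OF \<psi>] ddir_corr[OF test_function_cmult[OF test_function_ddir[OF \<psi>]]]
    ddir_cmult[OF ddir_smooth_bdd[OF test_function_smooth_bdd[OF \<psi>]]] corr_cmult by simp

lemma corr_shift: "corr u (\<lambda>y. \<psi> (y - a)) x = corr u \<psi> (x + a)"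
  by (simp add: corr_def algebra_simps)

end

section \<open>The pairing as a pointwise evaluation\<close>

text \<open>Superlevel sets of min(|z|^2, 1) have finite mass by Markov's inequality and exhaust the
  complement of 0. This is needed for Fubini.\<close>

lemma (in levy) sigma_finite_mu: "sigma_finite_measure \<mu>"
proof
  let ?A = "\<lambda>n::nat. {z\<in>space \<mu>. min ((norm z)\<^sup>2) 1 \<ge> 1 / real (Suc n)}"
  have f: "(\<lambda>z. min ((norm z)\<^sup>2) 1 :: real) \<in> borel_measurable \<mu>" using integrable_min by blast
  have "\<exists>n. 1 / real (Suc n) \<le> min ((norm z)\<^sup>2) 1" if "z \<noteq> 0" for z :: "real ^ 'n"
  proof -
    have "0 < min ((norm z)\<^sup>2) 1" using that by simp
    then obtain n where "inverse (real (Suc n)) < min ((norm z)\<^sup>2) 1" using reals_Archimedean by blast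
    then show ?thesis by (intro exI[of _ n]) (simp add: inverse_eq_divide)
  qed
  then have "(\<Union>n. ?A n) = space \<mu>" by (auto simp: space_mu)
  moreover have "?A n \<in> sets \<mu>" for n using f by measurable
  moreover have "emeasure \<mu> (?A n) \<noteq> \<infinity>" for n
  proof -
    have "emeasure \<mu> (?A n) \<le> ennreal (1 / (1 / real (Suc n)) * (LINT z|\<mu>. min ((norm z)\<^sup>2) 1))"
      by (rule integral_Markov_inequality[OF integrable_min]) auto
    then show ?thesis using ennreal_less_top neq_top_trans by (metis infinity_ennreal_def ennreal_neq_top)
  qed
  ultimately show "\<exists>A. countable A \<and> A \<subseteq> sets \<mu> \<and> \<Union>A = space \<mu> \<and> (\<forall>a\<in>A. emeasure \<mu> a \<noteq> \<infinity>)"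
    by (intro exI[of _ "range ?A"]) auto
qed

lemma (in levy) nonlocal_op_reflect:
  assumes "smooth_bdd f"
  shows "nonlocal_op (reflect_measure \<mu>) f x = (LINT z|\<mu>. jump f x (- z))"
  unfolding nonlocal_op_jump reflect_measure_def
proof (rule integral_distr)
  show "jump f x \<in> borel_measurable \<mu>" by (intro measurable_mu jump_measurable assms)
  show "uminus \<in> \<mu> \<rightarrow>\<^sub>M \<mu>"
  proof (rule measurableI)
    fix A assume "A \<in> sets \<mu>"
    then obtain C where C: "C \<in> sets borel" "A = C \<inter> - {0}" by (auto simp: sets_mu sets_restrict_space)
    have "uminus -` C \<in> sets borel" using measurable_sets[OF borel_measurable_uminus[OF measurable_ident] C(1)] by simp
    then have "uminus -` C - {0} \<in> sets \<mu>" by (intro in_sets_mu) auto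
    moreover have "uminus -` A \<inter> space \<mu> = uminus -` C - {0}" using C(2) by (auto simp: space_mu)
    ultimately show "uminus -` A \<inter> space \<mu> \<in> sets \<mu>" by simp
  qed (auto simp: space_mu)
qed

locale levy_pairing = levy \<mu> + bounded_borel u B
  for \<mu> :: "(real ^ 'n::finite) measure" and u :: "real ^ 'n \<Rightarrow> real" and B :: real
begin

sublocale pair_sigma_finite \<mu> lborel
  by (intro pair_sigma_finite.intro sigma_finite_mu sigma_finite_lborel)

text \<open>For fixed \<open>z\<close> the integrand lives on the balls of radius \<open>R\<close>
  around 0 and around \<open>z\<close>, whose volume does not depend on \<open>z\<close>. The inner
  integral is thus at most a constant times min(|z|^2, 1).\<close>

lemma pair_integrable:
  assumes \<psi>: "test_function \<psi>"
  shows "integrable (\<mu> \<Otimes>\<^sub>M lborel) (\<lambda>(z, y). u y * jump \<psi> y (- z))"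
proof -
  note \<psi>s = test_function_smooth_bdd[OF \<psi>]
  obtain R where R: "\<And>x. norm x > R \<Longrightarrow> \<psi> x = 0" "R > 0" using test_function_support[OF \<psi>] by blast
  obtain K where K: "K \<ge> 0" "\<And>x z. \<bar>jump \<psi> x z\<bar> \<le> K * min ((norm z)\<^sup>2) 1" using jump_bound[OF \<psi>s] by blast
  note [measurable] = smooth_bdd_borel[OF \<psi>s]
  have fst_m [measurable]: "fst \<in> borel_measurable (\<mu> \<Otimes>\<^sub>M lborel)"
    by (rule measurable_compose[OF measurable_fst]) (rule measurable_mu, simp)
  have [measurable]: "snd \<in> borel_measurable (\<mu> \<Otimes>\<^sub>M lborel)"
    using measurable_snd[of \<mu> lborel] by simp
  have [measurable]: "gradient \<psi> \<in> borel_measurable borel"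
    unfolding gradient_def[abs_def]
    by (intro borel_measurable_continuous_onI continuous_on_vec_lambda smooth_bdd_continuous smooth_bdd_partial \<psi>s)
  have [measurable]: "{z :: real ^ 'n. norm z \<le> 1} \<in> sets borel" by simp
  have meas: "(\<lambda>(z, y). u y * jump \<psi> y (- z)) \<in> borel_measurable (\<mu> \<Otimes>\<^sub>M lborel)"
    unfolding jump_def split_beta' by measurable
  have supp: "\<bar>u y * jump \<psi> y (- z)\<bar> \<le> B * (K * min ((norm z)\<^sup>2) 1) * (indicator (cball 0 R) y + indicator (cball z R) y)" for y z
  proof (cases "y \<in> cball 0 R \<or> y \<in> cball z R")
    case True
    have "\<bar>u y * jump \<psi> y (- z)\<bar> \<le> B * (K * min ((norm z)\<^sup>2) 1) * 1"
      unfolding abs_mult using mult_mono[OF u_bound[of y] K(2)[of y "- z"] B_nonneg] by (simp add: abs_mult)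
    also have "\<dots> \<le> B * (K * min ((norm z)\<^sup>2) 1) * (indicator (cball 0 R) y + indicator (cball z R) y)"
      using True B_nonneg K(1) by (intro mult_left_mono) (auto simp: indicator_def)
    finally show ?thesis .
  next
    case False
    then have "jump \<psi> y (- z) = 0"
      using gradient_outside_support[OF \<psi> R(1)] R(1)[of y] R(1)[of "y - z"]
      by (simp add: jump_def dist_norm norm_minus_commute)
    then show ?thesis using B_nonneg K(1) by simp
  qed
  have ind: "integrable lborel (indicator (cball c R) :: real ^ 'n \<Rightarrow> real)" for c
    by (intro integrable_real_indicator) (auto simp: emeasure_lborel_cball_finite[unfolded infinity_ennreal_def])
  have bi: "integrable lborel (\<lambda>y. B * (K * min ((norm z)\<^sup>2) 1) * (indicator (cball 0 R) y + indicator (cball z R) y) :: real)"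
    for z :: "real ^ 'n"
    by (intro integrable_mult_right Bochner_Integration.integrable_add ind)
  have mz: "(\<lambda>y. u y * jump \<psi> y (- z)) \<in> borel_measurable lborel" for z
    unfolding jump_def by measurable
  have iz: "integrable lborel (\<lambda>y. u y * jump \<psi> y (- z))" for z
    by (rule Bochner_Integration.integrable_bound[OF bi[of z] mz], rule always_eventually)
      (use supp abs_ge_self order_trans in \<open>unfold real_norm_def, blast\<close>)
  have vol: "measure lborel (cball z R) = measure lborel (cball (0 :: real ^ 'n) R)" for z :: "real ^ 'n"
    using R(2) by (simp add: content_cball)
  show ?thesis
  proof (rule Fubini_integrable[OF meas])
    show "AE z in \<mu>. integrable lborel (\<lambda>y. case (z, y) of (z, y) \<Rightarrow> u y * jump \<psi> y (- z))"
      using iz by simp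
    have bound: "(LINT y|lborel. norm (u y * jump \<psi> y (- z))) \<le> (2 * B * K * measure lborel (cball (0 :: real ^ 'n) R)) * min ((norm z)\<^sup>2) 1" for z
    proof -
      have "(LINT y|lborel. norm (u y * jump \<psi> y (- z))) \<le>
        (LINT y|lborel. B * (K * min ((norm z)\<^sup>2) 1) * (indicator (cball 0 R) y + indicator (cball z R) y))"
        using supp by (intro integral_mono integrable_norm iz bi) auto
      also have "\<dots> = B * (K * min ((norm z)\<^sup>2) 1) * (measure lborel (cball (0 :: real ^ 'n) R) + measure lborel (cball z R))"
        using ind by simp
      finally show ?thesis by (simp add: vol[of z] mult_ac)
    qed
    show "integrable \<mu> (\<lambda>z. LINT y|lborel. norm (case (z, y) of (z, y) \<Rightarrow> u y * jump \<psi> y (- z)))"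
    proof (rule Bochner_Integration.integrable_bound[OF integrable_mult_right[OF integrable_min]])
      show "(\<lambda>z. LINT y|lborel. norm (case (z, y) of (z, y) \<Rightarrow> u y * jump \<psi> y (- z))) \<in> borel_measurable \<mu>"
        using meas by (intro lborel.borel_measurable_lebesgue_integral) (simp add: split_beta')
      show "AE z in \<mu>. norm (LINT y|lborel. norm (case (z, y) of (z, y) \<Rightarrow> u y * jump \<psi> y (- z))) \<le>
        norm ((2 * B * K * measure lborel (cball (0 :: real ^ 'n) R)) * min ((norm z)\<^sup>2) 1)"
        unfolding prod.case
      proof (rule always_eventually, rule allI)
        fix z :: "real ^ 'n"
        have "0 \<le> (LINT y|lborel. norm (u y * jump \<psi> y (- z)))" by (intro Bochner_Integration.integral_nonneg) simp
        with bound[of z] show "norm (LINT y|lborel. norm (u y * jump \<psi> y (- z))) \<le>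
          norm ((2 * B * K * measure lborel (cball (0 :: real ^ 'n) R)) * min ((norm z)\<^sup>2) 1)" unfolding real_norm_def by linarith
      qed
    qed
  qed
qed

text \<open>After Fubini the integral over \<open>y\<close> is evaluated for each \<open>z\<close>.
  Reflecting \<open>z\<close> and differentiating the regularisation both reverse the sign of the
  first order term, so the inner integral is the jump of \<open>corr u \<psi>\<close> at 0.\<close>

lemma integrable_pairing:
  assumes \<psi>: "test_function \<psi>"
  shows "integrable lborel (\<lambda>y. u y * nonlocal_op (reflect_measure \<mu>) \<psi> y)"
    and "(LINT y|lborel. u y * nonlocal_op (reflect_measure \<mu>) \<psi> y) = nonlocal_op \<mu> (corr u \<psi>) 0"
proof -
  note \<psi>s = test_function_smooth_bdd[OF \<psi>]
  have e: "u y * nonlocal_op (reflect_measure \<mu>) \<psi> y = (LINT z|\<mu>. u y * jump \<psi> y (- z))" for y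
    by (simp add: nonlocal_op_reflect[OF \<psi>s])
  show "integrable lborel (\<lambda>y. u y * nonlocal_op (reflect_measure \<mu>) \<psi> y)"
    unfolding e by (rule integrable_snd[OF pair_integrable[OF \<psi>]])
  have "(LINT y|lborel. u y * nonlocal_op (reflect_measure \<mu>) \<psi> y) =
    (LINT z|\<mu>. LINT y|lborel. u y * jump \<psi> y (- z))"
    unfolding e by (rule Fubini_integral[OF pair_integrable[OF \<psi>]])
  also have "\<dots> = (LINT z|\<mu>. jump (corr u \<psi>) 0 z)"
  proof (rule Bochner_Integration.integral_cong[OF refl])
    fix z :: "real ^ 'n"
    let ?i = "indicator {z. norm z \<le> 1} z :: real"
    have ii: "indicator {z. norm z \<le> 1} (- z) = ?i" by (simp add: indicator_def)
    have i: "integrable lborel (\<lambda>y. u y * ddir z \<psi> y)" "integrable lborel (\<lambda>y. u y * \<psi> y)"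
      using corr_integrable[OF test_function_ddir[OF \<psi>], of z 0] corr_integrable[OF \<psi>, of 0] by simp_all
    have "z \<bullet> gradient (corr u \<psi>) 0 = ddir z (corr u \<psi>) 0" by (simp add: ddir_def)
    also have "\<dots> = - (LINT y|lborel. u y * ddir z \<psi> y)"
      unfolding ddir_corr[OF \<psi>] corr_cmult by (simp add: corr_def)
    finally have g: "z \<bullet> gradient (corr u \<psi>) 0 = - (LINT y|lborel. u y * ddir z \<psi> y)" .
    have "(LINT y|lborel. u y * jump \<psi> y (- z)) =
      (LINT y|lborel. u y * \<psi> (y - z) - u y * \<psi> y + u y * ddir z \<psi> y * ?i)"
      by (intro Bochner_Integration.integral_cong refl) (simp add: jump_def ddir_def ii algebra_simps)
    also have "\<dots> = (LINT y|lborel. u y * \<psi> (y - z)) - (LINT y|lborel. u y * \<psi> y) + (LINT y|lborel. u y * ddir z \<psi> y) * ?i"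
      using i by (simp add: corr_integrable[OF \<psi>])
    also have "\<dots> = jump (corr u \<psi>) 0 z" unfolding jump_def g by (simp add: corr_def)
    finally show "(LINT y|lborel. u y * jump \<psi> y (- z)) = jump (corr u \<psi>) 0 z" .
  qed
  finally show "(LINT y|lborel. u y * nonlocal_op (reflect_measure \<mu>) \<psi> y) = nonlocal_op \<mu> (corr u \<psi>) 0"
    by (simp add: nonlocal_op_jump)
qed

text \<open>Second derivatives pass from \<psi> to the regularisation with two signs and the drift
  with one, which accounts for \<open>- b\<close> in the adjoint.\<close>

lemma integral_adjoint_op:
  assumes \<psi>: "test_function \<psi>"
  shows "(LINT y|lborel. u y * adjoint_op \<sigma> b \<mu> \<psi> y) = full_op \<sigma> b \<mu> (corr u \<psi>) 0"
proof -
  let ?s = "\<lambda>j. column j \<sigma>"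
  note \<psi>s = test_function_smooth_bdd[OF \<psi>]
  have i: "integrable lborel (\<lambda>y. u y * \<phi> y)" if "test_function \<phi>" for \<phi>
    using corr_integrable[OF that, of 0] by simp
  note td = test_function_ddir[OF \<psi>] and tdd = test_function_ddir[OF test_function_ddir[OF \<psi>]]
  have "b \<bullet> gradient (corr u \<psi>) 0 = ddir b (corr u \<psi>) 0" by (simp add: ddir_def)
  then have drift: "b \<bullet> gradient (corr u \<psi>) 0 = - corr u (ddir b \<psi>) 0"
    unfolding ddir_corr[OF \<psi>] corr_cmult by simp
  have "u y * adjoint_op \<sigma> b \<mu> \<psi> y =
    (\<Sum>j\<in>UNIV. u y * ddir (?s j) (ddir (?s j) \<psi>) y) - u y * ddir b \<psi> y + u y * nonlocal_op (reflect_measure \<mu>) \<psi> y" for y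
    by (simp add: adjoint_op_def full_op_def local_op_eq \<psi>s ddir_def algebra_simps sum_distrib_left)
  then have "(LINT y|lborel. u y * adjoint_op \<sigma> b \<mu> \<psi> y) =
    (\<Sum>j\<in>UNIV. LINT y|lborel. u y * ddir (?s j) (ddir (?s j) \<psi>) y) - (LINT y|lborel. u y * ddir b \<psi> y)
      + nonlocal_op \<mu> (corr u \<psi>) 0"
    by (simp add: integrable_pairing[OF \<psi>] i td tdd)
  also have "\<dots> = (\<Sum>j\<in>UNIV. corr u (ddir (?s j) (ddir (?s j) \<psi>)) 0) - corr u (ddir b \<psi>) 0 + nonlocal_op \<mu> (corr u \<psi>) 0"
    by (simp add: corr_def)
  also have "(\<Sum>j\<in>UNIV. corr u (ddir (?s j) (ddir (?s j) \<psi>)) 0) - corr u (ddir b \<psi>) 0 + nonlocal_op \<mu> (corr u \<psi>) 0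
     = full_op \<sigma> b \<mu> (corr u \<psi>) 0"
    by (simp add: full_op_def local_op_eq corr_smooth_bdd[OF \<psi>] ddir_ddir_corr[OF \<psi>] drift)
  finally show ?thesis .
qed

end

lemma (in levy) adjoint_op_measurable:
  assumes \<psi>: "test_function \<psi>"
  shows "adjoint_op \<sigma> b \<mu> \<psi> \<in> borel_measurable borel"
proof -
  \<comment> \<open>For the constant function 1 the integrability of the pairing contains the
    measurability of the nonlocal term.\<close>
  interpret levy_pairing \<mu> "\<lambda>_. 1" 1 by unfold_locales auto
  note \<psi>s = test_function_smooth_bdd[OF \<psi>]
  have "integrable lborel (nonlocal_op (reflect_measure \<mu>) \<psi>)" using integrable_pairing(1)[OF \<psi>] by simp
  then have nm: "nonlocal_op (reflect_measure \<mu>) \<psi> \<in> borel_measurable borel"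
    using borel_measurable_integrable by fastforce
  have "adjoint_op \<sigma> b \<mu> \<psi> = (\<lambda>x. (\<Sum>j\<in>UNIV. ddir (column j \<sigma>) (ddir (column j \<sigma>) \<psi>) x) + ddir (- b) \<psi> x
    + nonlocal_op (reflect_measure \<mu>) \<psi> x)"
    by (simp add: adjoint_op_def full_op_def[abs_def] local_op_eq \<psi>s ddir_def fun_eq_iff)
  also have "\<dots> \<in> borel_measurable borel"
    by (intro borel_measurable_add nm smooth_bdd_borel smooth_bdd_sum ddir_smooth_bdd \<psi>s)
  finally show ?thesis .
qed

lemma (in levy_pairing) op_distribution_eq:
  assumes \<psi>: "test_function \<psi>" and v: "v \<in> borel_measurable lebesgue" "AE x in lebesgue. v x = u x"
  shows "op_distribution \<sigma> b \<mu> v \<psi> = full_op \<sigma> b \<mu> (corr u \<psi>) 0"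
proof -
  note [measurable] = adjoint_op_measurable[OF \<psi>, of \<sigma> b]
  have c: "f \<in> borel_measurable borel \<Longrightarrow> f \<in> borel_measurable lebesgue" for f :: "real ^ 'n \<Rightarrow> real"
    by (simp add: measurable_completion)
  have "op_distribution \<sigma> b \<mu> v \<psi> = (LINT x|lebesgue. u x * adjoint_op \<sigma> b \<mu> \<psi> x)"
    unfolding op_distribution_def
  proof (rule integral_cong_AE)
    show "(\<lambda>x. v x * adjoint_op \<sigma> b \<mu> \<psi> x) \<in> borel_measurable lebesgue"
      by (intro borel_measurable_times v c) measurable
    show "(\<lambda>x. u x * adjoint_op \<sigma> b \<mu> \<psi> x) \<in> borel_measurable lebesgue" by (rule c) measurable
    show "AE x in lebesgue. v x * adjoint_op \<sigma> b \<mu> \<psi> x = u x * adjoint_op \<sigma> b \<mu> \<psi> x" using v(2) by eventually_elim simp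
  qed
  also have "\<dots> = (LINT x|lborel. u x * adjoint_op \<sigma> b \<mu> \<psi> x)" by (rule integral_completion) simp
  finally show ?thesis by (simp add: integral_adjoint_op[OF \<psi>])
qed

section \<open>Functions with constant regularisations\<close>

lemma integral_lborel_reflect:
  fixes f :: "'a::euclidean_space \<Rightarrow> real"
  assumes [measurable]: "f \<in> borel_measurable borel"
  shows "(LINT y|lborel. f (c - y)) = (LINT y|lborel. f y)"
proof -
  have "lborel = distr lborel borel (\<lambda>x. c - x :: 'a)"
    using lborel_affine[of "-1" c] by (simp add: density_1)
  then have "(LINT y|lborel. f y) = (LINT y|distr lborel borel (\<lambda>x. c - x). f y)" by simp
  also have "\<dots> = (LINT y|lborel. f (c - y))" by (rule integral_distr) auto
  finally show ?thesis ..
qed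

context bounded_borel
begin

lemma integrable_indicator_corr:
  assumes A: "bounded A" "A \<in> sets borel"
  shows "integrable lborel (\<lambda>y. u y * indicator A (y - x))"
proof -
  note [measurable] = A(2)
  obtain R where R: "\<And>y. y \<in> A \<Longrightarrow> norm y \<le> R" using A(1) by (auto simp: bounded_iff)
  show ?thesis
  proof (rule integrable_bounded_support(1))
    show "(\<lambda>y. u y * indicator A (y - x)) \<in> borel_measurable borel" by measurable
    show "\<bar>u y * indicator A (y - x)\<bar> \<le> B" for y using u_bound[of y] B_nonneg by (simp add: indicator_def)
    show "y \<notin> cball x R \<Longrightarrow> u y * indicator A (y - x) = 0" for y
      using R[of "y - x"] by (auto simp: indicator_def dist_norm norm_minus_commute)
  qed
qed

text \<open>Both sides integrate \<open>u\<close> against the convolution of the two indicators,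
  which is symmetric under the substitution of \<open>y - x\<close> for \<open>x\<close>.\<close>

lemma corr_exchange:
  assumes A: "bounded A" "A \<in> sets borel" and Q: "bounded Q" "Q \<in> sets borel"
  shows "(LINT x|lborel. indicator Q x * corr u (indicator A) x) = (LINT x|lborel. indicator A x * corr u (indicator Q) x)"
proof -
  note [measurable] = A(2) Q(2)
  have int: "integrable (lborel \<Otimes>\<^sub>M lborel) (\<lambda>(x, y). indicator P x * (u y * indicator S (y - x)))"
    if P: "bounded P" "P \<in> sets borel" and S: "bounded S" "S \<in> sets borel" for P S :: "(real ^ 'n) set"
  proof -
    note [measurable] = P(2) S(2)
    obtain R1 R2 where R: "\<And>y. y \<in> P \<Longrightarrow> norm y \<le> R1" "\<And>y. y \<in> S \<Longrightarrow> norm y \<le> R2"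
      using P(1) S(1) unfolding bounded_iff by blast
    show ?thesis unfolding lborel_prod
    proof (rule integrable_bounded_support(1))
      show "(\<lambda>(x, y). indicator P x * (u y * indicator S (y - x))) \<in> borel_measurable borel"
        unfolding borel_prod[symmetric] by measurable
      show "\<bar>case z of (x, y) \<Rightarrow> indicator P x * (u y * indicator S (y - x))\<bar> \<le> B" for z
        using u_bound[of "snd z"] B_nonneg by (auto simp: indicator_def split: prod.split)
      show "(case z of (x, y) \<Rightarrow> indicator P x * (u y * indicator S (y - x))) = 0"
        if z: "z \<notin> cball 0 (R1 + (R1 + R2))" for z
      proof (rule ccontr)
        assume nz: "\<not> ?thesis"
        obtain x y where xy: "z = (x, y)" by (cases z)
        with nz have "x \<in> P" "y - x \<in> S" by (auto simp: indicator_def split: if_splits)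
        then have "norm x \<le> R1" "norm (y - x) \<le> R2" using R by auto
        moreover have "norm y \<le> norm x + norm (y - x)" using norm_triangle_ineq[of x "y - x"] by simp
        moreover have "norm z \<le> norm x + norm y" unfolding xy by (rule norm_Pair_le)
        ultimately show False using z by simp
      qed
    qed
  qed
  have L: "(LINT x|lborel. indicator P x * corr u (indicator S) x)
     = (LINT y|lborel. u y * (LINT x|lborel. indicator P x * indicator S (y - x)))"
    if P: "bounded P" "P \<in> sets borel" and S: "bounded S" "S \<in> sets borel" for P S :: "(real ^ 'n) set"
  proof -
    have "(LINT x|lborel. indicator P x * corr u (indicator S) x) =
      (LINT x|lborel. LINT y|lborel. indicator P x * (u y * indicator S (y - x)))"
      by (simp add: corr_def)
    also have "\<dots> = (LINT y|lborel. LINT x|lborel. indicator P x * (u y * indicator S (y - x)))"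
      by (rule lborel_pair.Fubini_integral[symmetric]) (rule int[OF P S])
    also have "\<dots> = (LINT y|lborel. LINT x|lborel. u y * (indicator P x * indicator S (y - x)))"
      by (intro Bochner_Integration.integral_cong refl) simp
    finally show ?thesis by simp
  qed
  have "(LINT x|lborel. indicator Q x * indicator A (y - x)) = (LINT x|lborel. indicator A x * indicator Q (y - x) :: real)" for y
    using integral_lborel_reflect[of "\<lambda>x. indicator Q x * indicator A (y - x)" y] by (simp add: mult.commute)
  then show ?thesis unfolding L[OF Q A] L[OF A Q] by simp
qed

lemma corr_box_const:
  assumes c: "\<And>\<psi> x. test_function \<psi> \<Longrightarrow> corr u \<psi> x = corr u \<psi> 0"
    and lu: "\<And>i. l $ i < r $ i"
  shows "corr u (indicator (box l r)) x = corr u (indicator (box l r)) 0"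
proof -
  obtain \<psi> :: "nat \<Rightarrow> real ^ 'n \<Rightarrow> real" where \<psi>: "\<And>n. test_function (\<psi> n)" "\<And>n x. 0 \<le> \<psi> n x \<and> \<psi> n x \<le> indicator (box l r) x"
    "\<And>x. (\<lambda>n. \<psi> n x) \<longlonglongrightarrow> indicator (box l r) x" using test_functions_approach_box[OF lu] by blast
  have lim: "(\<lambda>n. corr u (\<psi> n) x) \<longlonglongrightarrow> corr u (indicator (box l r)) x" for x
    unfolding corr_def
  proof (rule integral_dominated_convergence)
    show "integrable lborel (\<lambda>y. B * indicator (box l r) (y - x))"
    proof -
      interpret one: bounded_borel "\<lambda>_. B" B using B_nonneg by unfold_locales auto
      show ?thesis by (rule one.integrable_indicator_corr) auto
    qed
    show "(\<lambda>y. u y * indicator (box l r) (y - x)) \<in> borel_measurable lborel" by measurable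
    show "(\<lambda>y. u y * \<psi> n (y - x)) \<in> borel_measurable lborel" for n
      using corr_integrable[OF \<psi>(1)] by blast
    show "AE y in lborel. (\<lambda>n. u y * \<psi> n (y - x)) \<longlonglongrightarrow> u y * indicator (box l r) (y - x)"
      by (intro always_eventually allI tendsto_mult tendsto_const \<psi>(3))
    show "AE y in lborel. norm (u y * \<psi> n (y - x)) \<le> B * indicator (box l r) (y - x)" for n
    proof (rule always_eventually, rule allI)
      fix y
      have "\<bar>\<psi> n (y - x)\<bar> \<le> indicator (box l r) (y - x)" using \<psi>(2)[of n "y - x"] by simp
      then show "norm (u y * \<psi> n (y - x)) \<le> B * indicator (box l r) (y - x)"
        unfolding real_norm_def abs_mult by (intro mult_mono u_bound B_nonneg) auto
    qed
  qed
  have "(\<lambda>n. corr u (\<psi> n) x) \<longlonglongrightarrow> corr u (indicator (box l r)) 0"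
    using lim[of 0] by (simp only: c[OF \<psi>(1), of _ x])
  then show ?thesis by (rule LIMSEQ_unique[OF lim])
qed

text \<open>
  The integral of \<open>u\<close> over a box depends only on the box up to translation; exchanging the roles
  of the box and of a unit cube, it is proportional to the volume. Shifting \<open>u\<close> by a constant makes
  it a density.
\<close>

lemma AE_const_of_corr_const:
  assumes c: "\<And>\<psi> x. test_function \<psi> \<Longrightarrow> corr u \<psi> x = corr u \<psi> 0"
  shows "\<exists>c. AE y in lborel. u y = c"
proof -
  define Q where "Q = box (0 :: real ^ 'n) 1"
  define a where "a = corr u (indicator Q) 0"
  have Q: "bounded Q" "Q \<in> sets borel" by (auto simp: Q_def)
  have b1: "1 \<bullet> b = 1" if "b \<in> Basis" for b :: "real ^ 'n"
    using that by (auto simp: Basis_vec_def inner_axis)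
  have Q1: "measure lborel Q = 1"
    unfolding Q_def by (subst measure_lborel_box) (auto simp: b1)
  have box_integral: "(LINT y|lborel. u y * indicator (box l r) y) = a * measure lborel (box l r)"
    if lr: "\<And>i. l $ i < r $ i" for l r :: "real ^ 'n"
  proof -
    define A where "A = box l r"
    have A: "bounded A" "A \<in> sets borel" by (auto simp: A_def)
    have cA: "corr u (indicator A) x = corr u (indicator A) 0" for x
      unfolding A_def by (rule corr_box_const[OF c lr])
    have cQ: "corr u (indicator Q) x = a" for x
      unfolding a_def Q_def by (rule corr_box_const[OF c]) auto
    \<comment> \<open>Averaging a constant over the unit cube changes nothing; after the exchange it
      is the integral of the constant \<open>a\<close> over \<open>A\<close>.\<close>
    have "corr u (indicator A) 0 = (LINT x|lborel. indicator Q x * corr u (indicator A) x)"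
      by (subst cA) (use Q Q1 in simp)
    also have "\<dots> = (LINT x|lborel. indicator A x * corr u (indicator Q) x)"
      by (rule corr_exchange) (use A Q in auto)
    also have "\<dots> = a * measure lborel A" by (subst cQ) (use A in \<open>simp add: mult.commute\<close>)
    finally show ?thesis by (simp add: corr_def A_def)
  qed
  \<comment> \<open>Since |u| is at most \<open>B\<close>, both \<open>u y + k\<close> and
    \<open>a + k\<close> are at least 1.\<close>
  define k where "k = B + \<bar>a\<bar> + 1"
  have k: "a + k > 0" "u y + k > 0" for y using u_bound[of y] B_nonneg unfolding k_def by linarith+
  define f where "f y = (u y + k) / (a + k)" for y
  have f0: "f y \<ge> 0" for y using k by (simp add: f_def less_imp_le)
  have [measurable]: "f \<in> borel_measurable borel" unfolding f_def[abs_def] by measurable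
  \<comment> \<open>A measure with the right mass on boxes is Lebesgue measure; uniqueness of
    densities then gives \<open>f = 1\<close> almost everywhere.\<close>
  have "lborel = density lborel (\<lambda>y. ennreal (f y))"
  proof (rule lborel_eqI)
    fix l r :: "real ^ 'n"
    assume le: "\<And>b. b \<in> Basis \<Longrightarrow> l \<bullet> b \<le> r \<bullet> b"
    have "emeasure (density lborel (\<lambda>y. ennreal (f y))) (box l r) = emeasure lborel (box l r)"
    proof (cases "\<forall>i. l $ i < r $ i")
      case True
      then have lr: "\<And>i. l $ i < r $ i" by blast
      have ib: "integrable lborel (indicator (box l r) :: real ^ 'n \<Rightarrow> real)"
        using integrable_real_indicator[of "box l r" lborel] by (simp add: emeasure_lborel_box_eq)
      have iu: "integrable lborel (\<lambda>y. u y * indicator (box l r) y)"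
        using integrable_indicator_corr[of "box l r" 0] by simp
      have e: "f y * indicator (box l r) y = (u y * indicator (box l r) y + k * indicator (box l r) y) / (a + k)" for y
        by (simp add: f_def field_simps)
      have if': "integrable lborel (\<lambda>y. f y * indicator (box l r) y)"
        unfolding e using iu ib by simp
      have "(LINT y|lborel. f y * indicator (box l r) y)
        = (a * measure lborel (box l r) + k * measure lborel (box l r)) / (a + k)"
        unfolding e using iu ib box_integral[OF lr] by simp
      also have "\<dots> = measure lborel (box l r)" using k(1) by (simp add: field_simps)
      finally have I: "(LINT y|lborel. f y * indicator (box l r) y) = measure lborel (box l r)" .
      have "emeasure (density lborel (\<lambda>y. ennreal (f y))) (box l r) = (\<integral>\<^sup>+ y. ennreal (f y) * indicator (box l r) y \<partial>lborel)"
        by (rule emeasure_density) auto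
      also have "\<dots> = (\<integral>\<^sup>+ y. ennreal (f y * indicator (box l r) y) \<partial>lborel)"
        by (intro nn_integral_cong) (simp add: indicator_def)
      also have "\<dots> = ennreal (measure lborel (box l r))"
        unfolding I[symmetric] by (rule nn_integral_eq_integral[OF if']) (use f0 in auto)
      also have "\<dots> = emeasure lborel (box l r)"
        by (rule emeasure_eq_ennreal_measure[symmetric]) (simp add: emeasure_lborel_box_eq)
      finally show ?thesis .
    next
      case False
      then have "box l r = {}" by (auto simp: mem_box_cart) (meson less_trans)
      then show ?thesis by simp
    qed
    also have "\<dots> = ennreal (\<Prod>b\<in>Basis. (r - l) \<bullet> b)" using le by (simp add: emeasure_lborel_box)
    finally show "emeasure (density lborel (\<lambda>y. ennreal (f y))) (box l r) = ennreal (\<Prod>b\<in>Basis. (r - l) \<bullet> b)" .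
  qed simp
  then have "density lborel (\<lambda>y. ennreal (f y)) = density lborel (\<lambda>y. 1)" by (simp add: density_1)
  then have "AE y in lborel. ennreal (f y) = 1"
    by (intro sigma_finite_measure.density_unique[OF sigma_finite_lborel]) auto
  then have "AE y in lborel. u y = a"
  proof eventually_elim
    case (elim y)
    then have "f y = 1" using f0[of y] by (simp add: ennreal_eq_1)
    then show ?case using k(1) by (simp add: f_def)
  qed
  then show ?thesis by blast
qed

end

lemma AE_const_imp_const:
  fixes u :: "real ^ 'n::finite \<Rightarrow> real"
  assumes cont: "continuous_on UNIV u" and ae: "AE x in lebesgue. u x = c"
  shows "u x = c"
proof (rule ccontr)
  assume "u x \<noteq> c"
  have "open {x. u x \<noteq> c}" by (intro open_Collect_neq cont continuous_intros)
  moreover have "negligible {x. u x \<noteq> c}"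
    using ae negligible_subset unfolding negligible_iff_null_sets eventually_ae_filter by auto
  ultimately show False using open_not_negligible \<open>u x \<noteq> c\<close> by blast
qed

lemma L_infty_borel_representative:
  fixes v :: "real ^ 'n::finite \<Rightarrow> real"
  assumes "v \<in> L_infty"
  obtains u B where "bounded_borel u B" "AE x in lebesgue. v x = u x"
proof -
  from assms obtain C where v: "v \<in> borel_measurable lebesgue" and C: "AE x in lebesgue. \<bar>v x\<bar> \<le> C"
    by (auto simp: L_infty_def)
  obtain g where g [measurable]: "g \<in> borel_measurable lborel" and vg: "AE x in lborel. v x = g x"
    using completion_ex_borel_measurable_real[OF v] by blast
  define B where "B = \<bar>C\<bar>"
  \<comment> \<open>Clipping makes the bound hold everywhere and changes the Borel version
    \<open>g\<close> on a null set only.\<close>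
  define u where "u x = max (- B) (min B (g x))" for x
  have [measurable]: "g \<in> borel_measurable borel" using g by simp
  have "bounded_borel u B" by unfold_locales (auto simp: u_def[abs_def] B_def)
  moreover have "AE x in lebesgue. v x = u x"
    using C AE_completion[OF vg] by eventually_elim (auto simp: u_def B_def)
  ultimately show thesis by (rule that)
qed

section \<open>The equivalence\<close>

lemma corr_translate:
  assumes [measurable]: "u \<in> borel_measurable borel" and \<psi>: "test_function \<psi>" and h: "h \<in> periods u"
  shows "h \<in> periods (corr u \<psi>)"
proof -
  note [measurable] = smooth_bdd_borel[OF test_function_smooth_bdd[OF \<psi>]]
  have "corr u \<psi> (x + h) = corr u \<psi> x" for x
  proof -
    have "(\<lambda>y. u y * \<psi> (y - (x + h))) \<in> borel_measurable borel" by measurable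
    from integral_lborel_shift[OF this, of h] show ?thesis
      using h by (simp add: corr_def periods_def)
  qed
  then show ?thesis by (simp add: periods_def)
qed

text \<open>A translation mapping \<open>S\<close> into itself does not increase the distance to
  \<open>S\<close>; applied to \<open>h\<close> and \<open>- h\<close> this gives equality.\<close>

lemma infdist_periods:
  assumes ne: "S \<noteq> {}" and h: "\<And>s. s \<in> S \<Longrightarrow> s + h \<in> S" "\<And>s. s \<in> S \<Longrightarrow> s - h \<in> S"
  shows "h \<in> periods (\<lambda>x. min 1 (infdist x S))"
proof -
  have le: "infdist (x + k) S \<le> infdist x S" if "\<And>s. s \<in> S \<Longrightarrow> s + k \<in> S" for x k
    unfolding infdist_notempty[OF ne, of x]
  proof (rule cINF_greatest[OF ne])
    fix s assume "s \<in> S"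
    then have "infdist (x + k) S \<le> dist (x + k) (s + k)" by (intro infdist_le that)
    then show "infdist (x + k) S \<le> dist x s" by simp
  qed
  have "infdist (x + h) S = infdist x S" for x
    using le[OF h(1), of x] le[of "- h" "x + h"] h(2) by auto
  then show ?thesis by (simp add: periods_def)
qed

context levy
begin

lemma liouville_if_dense:
  assumes dense: "closure {g + w | g w. g \<in> G_of \<mu> \<and> w \<in> W_of \<sigma> (b + c_of \<mu>)} = UNIV"
    and v: "v \<in> L_infty" and eq: "\<And>\<psi>. test_function \<psi> \<Longrightarrow> op_distribution \<sigma> b \<mu> v \<psi> = 0"
  shows "\<exists>c. AE x in lebesgue. v x = c"
proof -
  obtain u B where uB: "bounded_borel u B" and vu: "AE x in lebesgue. v x = u x"
    by (rule L_infty_borel_representative[OF v])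
  interpret levy_pairing \<mu> u B by (intro levy_pairing.intro uB) unfold_locales
  have v': "v \<in> borel_measurable lebesgue" using v by (simp add: L_infty_def)
  have const: "corr u \<psi> x = corr u \<psi> 0" if \<psi>: "test_function \<psi>" for \<psi> x
  proof -
    note s = corr_smooth_bdd[OF \<psi>]
    have z: "full_op \<sigma> b \<mu> (corr u \<psi>) x = 0" for x
    proof -
      have t: "test_function (\<lambda>y. \<psi> (y - x))" using test_function_shift[OF \<psi>, of "- x"] by simp
      \<comment> \<open>Translating the test function moves the point of evaluation from 0 to
        \<open>x\<close>.\<close>
      have "full_op \<sigma> b \<mu> (corr u \<psi>) (0 + x) = full_op \<sigma> b \<mu> (corr u (\<lambda>y. \<psi> (y - x))) 0"
        unfolding full_op_shift[OF s, symmetric] corr_shift[abs_def, of \<psi> x, symmetric] ..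
      also have "\<dots> = 0" using eq[OF t] by (simp add: op_distribution_eq[OF t v' vu])
      finally show ?thesis by simp
    qed
    have "{g + w | g w. g \<in> G_of \<mu> \<and> w \<in> W_of \<sigma> (b + c_of \<mu>)} \<subseteq> periods (corr u \<psi>)"
      using liouville_periods[OF s z] add_periods by blast
    \<comment> \<open>The periods of a continuous function form a closed set, so density of the
      group suffices.\<close>
    then have "UNIV \<subseteq> periods (corr u \<psi>)"
      unfolding dense[symmetric] by (intro closure_minimal closed_periods smooth_bdd_continuous s)
    then have "x \<in> periods (corr u \<psi>)" by blast
    then have "corr u \<psi> (0 + x) = corr u \<psi> 0" unfolding periods_def by blast
    then show ?thesis by simp
  qed
  obtain c where "AE x in lborel. u x = c" using AE_const_of_corr_const[OF const] by blast
  then have "AE x in lebesgue. u x = c" by (rule AE_completion)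
  with vu have "AE x in lebesgue. v x = c" by eventually_elim simp
  then show ?thesis by blast
qed

lemma dense_if_liouville:
  assumes L: "\<And>u. u \<in> L_infty \<Longrightarrow> (\<And>\<psi>. test_function \<psi> \<Longrightarrow> op_distribution \<sigma> b \<mu> u \<psi> = 0)
    \<Longrightarrow> \<exists>c. AE x in lebesgue. u x = c"
  shows "closure {g + w | g w. g \<in> G_of \<mu> \<and> w \<in> W_of \<sigma> (b + c_of \<mu>)} = UNIV"
proof -
  define S where "S = {g + w | g w. g \<in> G_of \<mu> \<and> w \<in> W_of \<sigma> (b + c_of \<mu>)}"
  \<comment> \<open>Truncation makes it bounded; its zero set is exactly the closure of
    \<open>S\<close>.\<close>
  define u where "u x = min 1 (infdist x S)" for x
  have sW: "subspace (W_of \<sigma> (b + c_of \<mu>))" by (simp add: W_of_def)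
  have neg: "- h \<in> G_of \<mu>" if "h \<in> G_of \<mu>" for h using G_of_group(2)[OF G_of_group(1) that] by simp
  have G_add: "g + h \<in> G_of \<mu>" if "g \<in> G_of \<mu>" "h \<in> G_of \<mu>" for g h
    using G_of_group(2)[OF that(1) neg[OF that(2)]] by simp
  have "0 + 0 \<in> S" unfolding S_def using G_of_group(1)[of \<mu>] subspace_0[OF sW] by blast
  then have S0: "0 \<in> S" by simp
  then have ne: "S \<noteq> {}" by blast
  have SG: "s + h \<in> S" if s: "s \<in> S" and h: "h \<in> G_of \<mu>" for s h
  proof -
    obtain g w where gw: "s = g + w" "g \<in> G_of \<mu>" "w \<in> W_of \<sigma> (b + c_of \<mu>)" using s by (auto simp: S_def)
    then have "s + h = (g + h) + w" by simp
    then show ?thesis unfolding S_def using gw G_add[OF gw(2) h] by blast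
  qed
  have SW: "s + h \<in> S" if s: "s \<in> S" and h: "h \<in> W_of \<sigma> (b + c_of \<mu>)" for s h
  proof -
    obtain g w where gw: "s = g + w" "g \<in> G_of \<mu>" "w \<in> W_of \<sigma> (b + c_of \<mu>)" using s by (auto simp: S_def)
    then have "s + h = g + (w + h)" by simp
    then show ?thesis unfolding S_def using gw subspace_add[OF sW gw(3) h] by blast
  qed
  have pG: "G_of \<mu> \<subseteq> periods u"
    unfolding u_def[abs_def] using SG neg by (fastforce intro!: infdist_periods[OF ne])
  have pW: "W_of \<sigma> (b + c_of \<mu>) \<subseteq> periods u"
    unfolding u_def[abs_def] using SW subspace_neg[OF sW] by (fastforce intro!: infdist_periods[OF ne])
  have cont: "continuous_on UNIV u" unfolding u_def[abs_def] by (intro continuous_intros)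
  have ub: "u \<in> borel_measurable borel" by (rule borel_measurable_continuous_onI[OF cont])
  have u1: "\<bar>u x\<bar> \<le> 1" for x using infdist_nonneg[of x S] by (simp add: u_def)
  interpret levy_pairing \<mu> u 1 by unfold_locales (rule ub, rule u1)
  have ul: "u \<in> borel_measurable lebesgue" using ub by (simp add: measurable_completion)
  have "u \<in> L_infty" unfolding L_infty_def using ul u1 by (auto intro!: exI[of _ 1])
  moreover have "op_distribution \<sigma> b \<mu> u \<psi> = 0" if \<psi>: "test_function \<psi>" for \<psi>
  proof -
    \<comment> \<open>The operator is applied to a smooth regularisation only, which has all the
      periods of \<open>u\<close>.\<close>
    have "op_distribution \<sigma> b \<mu> u \<psi> = full_op \<sigma> b \<mu> (corr u \<psi>) 0"
      by (rule op_distribution_eq[OF \<psi> ul]) simp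
    also have "\<dots> = 0"
      using corr_translate[OF ub \<psi>] pG pW by (intro full_op_zero_of_periods corr_smooth_bdd \<psi>) blast+
    finally show ?thesis .
  qed
  ultimately obtain c where "AE x in lebesgue. u x = c" using L by blast
  then have c: "u x = c" for x by (rule AE_const_imp_const[OF cont])
  have "u 0 = 0" using S0 by (simp add: u_def)
  then have "infdist x S = 0" for x using c[of x] c[of 0] by (simp add: u_def min_def split: if_splits)
  then have "x \<in> closure S" for x using in_closure_iff_infdist_zero[OF ne] by blast
  then show ?thesis unfolding S_def by blast
qed

end

theorem theorem1p1:
  fixes \<sigma> :: "real ^ 'p::finite ^ 'n::finite"
    and b :: "real ^ 'n"
    and \<mu> :: "(real ^ 'n) measure"
  assumes "levy_measure \<mu>"
  shows "(\<forall>u \<in> L_infty.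
            (\<forall>\<psi>. test_function \<psi> \<longrightarrow> op_distribution \<sigma> b \<mu> u \<psi> = 0)
              \<longrightarrow> (\<exists>c. AE x in lebesgue. u x = c))
         \<longleftrightarrow> closure {g + w | g w. g \<in> G_of \<mu> \<and> w \<in> W_of \<sigma> (b + c_of \<mu>)} = UNIV"
proof -
  interpret levy \<mu> by (rule levy.intro[OF assms])
  show ?thesis using dense_if_liouville[of \<sigma> b] liouville_if_dense[of \<sigma> b] by blast
qed

end
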